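(* Let $f(z)=\sum_{n=0}^\infty \alpha_n z^n$ be a transcendental entire solution of $$\sum_{j=0}^m a_j(z)f(q^jz)=b(z),$$ with growth given by $$\log M(r,f)\sim \frac{\sigma_k}{-2\log|q|}(\log r)^2\qquad (r\to\infty),$$ where $k\in\{1,\dots,K\}$. With this $k$, let $M$, $N$, $\rho$ and the characteristic polynomial $P_k$ associated to $\sigma_k$ be as defined in the context, and let $\lambda_1,\dots,\lambda_l$ be the roots of $P_k$, with multiplicities $m_1,\dots,m_l$, so that $\sum_{j=1}^l m_j=M$. Then there exist $\mu\in\{|\lambda_j|\colon 1\le j\le l\}$ and for each $j$ with $|\lambda_j|=\mu$ a polynomial $Q_j$ with $\deg Q_j\le m_j-1$, not all $Q_j$ vanishing identically, such that $$\alpha_n\rho^{-Nn^2}=\sum_{\{j\colon|\lambda_j|=\mu\}}Q_j(n)\lambda_j^n+O(\delta^n)$$ for some $\delta\in(0,\mu)$ as $n\to\infty$. In fact, this holds for any $\delta$ satisfying $$\delta>\max_{\{j\colon|\lambda_j|<\mu\}}|\lambda_j|\quad\text{and}\quad \delta>|\rho|^2\mu.$$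
   Context: Setting: $q\in\mathbb{C}$ with $0<|q|<1$; $b$ and $a_0,\dots,a_m$ are polynomials. Put $M(r,f)=\max_{|z|=r}|f(z)|$. Newton-Puiseux diagram: let $d(j)$ denote the degree of $a_j$. The diagram $P$ is the convex hull of $\bigcup_{j=0}^m\{(x,y)\in\mathbb{R}^2\colon x\ge j \text{ and } y\le d(j)\}$. Its vertices are $(j_k,d(j_k))$, $k\in\{0,\dots,K\}$, with $0=j_0<j_1<\dots<j_K\le m$. For $k\in\{1,\dots,K\}$ put $$\sigma_k=\frac{d(j_k)-d(j_{k-1})}{j_k-j_{k-1}};$$ then $\sigma_1>\sigma_2>\dots>\sigma_K>0$. (Existence of a transcendental entire solution implies $K\ge1$, and for each such solution there is a $k\in\{1,\dots,K\}$ with the growth asymptotics in the claim.) For this $k$ put $M=d(j_k)-d(j_{k-1})$, $N=j_k-j_{k-1}$ (so $\sigma_k=M/N$), and $\rho=q^{1/(2M)}$ for some fixed branch of the root. Let $I_k$ be the set of all $j\in\{0,\dots,m\}$ for which $(j,d(j))$ lies on the line through $(j_{k-1},d(j_{k-1}))$ and $(j_k,d(j_k))$. Write $a_j(z)=\sum_{i=0}^{d(j)}a_{j,i}z^i$ and put $c_{j,i}=a_{j,i}\rho^{Ni^2}q^{-ji}$. The characteristic polynomial associated to $\sigma_k$ is $$P_k(z)=\sum_{j\in I_k}c_{j,d(j)}z^{d(j)-d(j_{k-1})}.$$ It has degree $M$, and $P_k(0)=c_{j_{k-1},d(j_{k-1})}\ne0$.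
   Formalization: The λ_j are taken to be the reciprocals of the roots of P_k (the roots of z^M P_k(1/z)), with the same multiplicities; with the roots of P_k themselves the claim fails, e.g. for f(z) − z f(qz) = 1. *)

theory Defs
  imports
    "HOL-Complex_Analysis.Complex_Analysis"
    "HOL-Computational_Algebra.Polynomial"
    "HOL-Library.Landau_Symbols"
begin

definition max_modulus :: "real \<Rightarrow> (complex \<Rightarrow> complex) \<Rightarrow> real" where
  "max_modulus r f = (SUP z\<in>sphere 0 r. norm (f z))"

definition transcendental_entire :: "(complex \<Rightarrow> complex) \<Rightarrow> bool" where
  "transcendental_entire f \<longleftrightarrow> f holomorphic_on UNIV \<and> \<not> (\<exists>p. \<forall>z. f z = poly p z)"

text \<open>
  The zero polynomial has degree minus infinity here, so it contributes nothing to the diagram;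
  the condition \<open>a j \<noteq> 0\<close> is needed because the library sets \<open>degree 0 = 0\<close>.
\<close>
definition newton_puiseux :: "nat \<Rightarrow> (nat \<Rightarrow> complex poly) \<Rightarrow> (real \<times> real) set" where
  "newton_puiseux m a =
     convex hull (\<Union>j\<in>{j. j \<le> m \<and> a j \<noteq> 0}. {(x, y). real j \<le> x \<and> y \<le> real (degree (a j))})"

definition diagram_point :: "(nat \<Rightarrow> complex poly) \<Rightarrow> nat \<Rightarrow> real \<times> real" where
  "diagram_point a j = (real j, real (degree (a j)))"

definition newton_puiseux_vertices ::
    "nat \<Rightarrow> (nat \<Rightarrow> complex poly) \<Rightarrow> nat \<Rightarrow> (nat \<Rightarrow> nat) \<Rightarrow> bool" where
  "newton_puiseux_vertices m a K jv \<longleftrightarrow>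
     jv 0 = 0 \<and> strict_mono_on {0..K} jv \<and> jv K \<le> m \<and>
     {v. v extreme_point_of newton_puiseux m a} = (\<lambda>k. diagram_point a (jv k)) ` {0..K}"

definition slope :: "(nat \<Rightarrow> complex poly) \<Rightarrow> (nat \<Rightarrow> nat) \<Rightarrow> nat \<Rightarrow> real" where
  "slope a jv k =
     (real (degree (a (jv k))) - real (degree (a (jv (k - 1))))) / (real (jv k) - real (jv (k - 1)))"

text \<open>
  The natural-number subtractions below, in \<open>edge_height\<close>, \<open>edge_width\<close> and
  \<open>char_poly\<close>, do not truncate when \<open>jv\<close> enumerates the vertices and \<open>1 \<le> k \<le> K\<close>:
  the vertices move strictly right and strictly up, and the diagram meets the line through two
  consecutive vertices only in the segment between them.
\<close>
definition edge_height :: "(nat \<Rightarrow> complex poly) \<Rightarrow> (nat \<Rightarrow> nat) \<Rightarrow> nat \<Rightarrow> nat" where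
  "edge_height a jv k = degree (a (jv k)) - degree (a (jv (k - 1)))"

definition edge_width :: "(nat \<Rightarrow> nat) \<Rightarrow> nat \<Rightarrow> nat" where
  "edge_width jv k = jv k - jv (k - 1)"

definition edge_indices ::
    "nat \<Rightarrow> (nat \<Rightarrow> complex poly) \<Rightarrow> (nat \<Rightarrow> nat) \<Rightarrow> nat \<Rightarrow> nat set" where
  "edge_indices m a jv k =
     {j. j \<le> m \<and> a j \<noteq> 0 \<and>
         diagram_point a j \<in> affine hull {diagram_point a (jv (k - 1)), diagram_point a (jv k)}}"

definition twisted_coeff ::
    "complex \<Rightarrow> complex \<Rightarrow> nat \<Rightarrow> (nat \<Rightarrow> complex poly) \<Rightarrow> nat \<Rightarrow> nat \<Rightarrow> complex" where
  "twisted_coeff q \<rho> N a j i = coeff (a j) i * \<rho> ^ (N * i\<^sup>2) * q powi (- int (j * i))"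

definition char_poly ::
    "complex \<Rightarrow> complex \<Rightarrow> nat \<Rightarrow> (nat \<Rightarrow> complex poly) \<Rightarrow> (nat \<Rightarrow> nat) \<Rightarrow> nat \<Rightarrow> complex poly" where
  "char_poly q \<rho> m a jv k =
     (\<Sum>j\<in>edge_indices m a jv k.
        monom (twisted_coeff q \<rho> (edge_width jv k) a j (degree (a j)))
              (degree (a j) - degree (a (jv (k - 1)))))"

text \<open>
  The exponential rates in the asymptotics of the Taylor coefficients are the \<^emph>\<open>reciprocals\<close>
  of the roots of \<open>char_poly\<close>, that is, the roots of the reciprocal polynomial
  \<open>z ^ M * P (1 / z)\<close>, with the same multiplicities. (The roots of \<open>char_poly\<close> themselves
  would be wrong: \<open>f z = (\<Sum>n. q ^ (n * (n - 1) div 2) * z ^ n)\<close> solves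
  \<open>f z - z * f (q * z) = 1\<close>, here \<open>M = N = 1\<close>, \<open>\<rho>\<^sup>2 = q\<close>, the characteristic polynomial is
  \<open>1 - z / \<rho>\<close> with root \<open>\<rho>\<close>, but the normalised coefficients are \<open>(1 / \<rho>) ^ n\<close>.)
\<close>
definition rate_poly ::
    "complex \<Rightarrow> complex \<Rightarrow> nat \<Rightarrow> (nat \<Rightarrow> complex poly) \<Rightarrow> (nat \<Rightarrow> nat) \<Rightarrow> nat \<Rightarrow> complex poly" where
  "rate_poly q \<rho> m a jv k = reflect_poly (char_poly q \<rho> m a jv k)"

end

theory Submission
  imports Defs "HOL-Computational_Algebra.Fundamental_Theorem_Algebra"
begin

text \<open>
  Comparing coefficients in the \<open>q\<close>-difference equation gives, for large \<open>n\<close>, a linear recurrence for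
  the Taylor coefficients \<open>\<alpha> n\<close>. After the substitution \<open>\<alpha> n = \<rho> ^ (N * n\<^sup>2) * \<beta> n\<close> the monomial \<open>z ^ i\<close>
  of \<open>a j\<close> contributes the term \<open>c j i * (\<rho>\<^sup>2) ^ (n * (M * j - N * i)) * \<beta> (n - i)\<close>, up to a common factor.
  The exponent \<open>M * j - N * i\<close> measures, up to an additive constant, how far the point \<open>(j, i)\<close>
  lies below the line through the chosen edge of the Newton-Puiseux diagram. The points of the edge
  therefore give a recurrence with constant coefficients, whose characteristic polynomial is the
  reciprocal of the characteristic polynomial of the edge, and all other terms carry a factor
  \<open>O((\<rho>\<^sup>2) ^ n)\<close>. These other terms can also involve values of \<open>\<beta>\<close> with larger indices than the main
  part does. Then the recurrence does not determine \<open>\<beta>\<close> step by step and can have solutions of very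
  different growth.
  The lemma \<open>normalized_coeff_perturbed_recurrence\<close> carries out this reduction, on the basis of
  \<open>newton_puiseux_edge\<close>.

  The growth hypothesis selects the right kind of solution. By Cauchy's inequality, and by estimating
  the power series from above, it implies that \<open>\<bar>\<beta> n\<bar>\<close> is at most \<open>exp (\<epsilon> * n\<^sup>2)\<close> for every \<open>\<epsilon> > 0\<close>,
  up to a constant factor, and not at most a constant times \<open>exp (- c * n\<^sup>2)\<close> for any \<open>c > 0\<close>.

  Put \<open>\<eta> = \<bar>\<rho>\<bar>\<^sup>2\<close>. The first bound makes every perturbation term small against the main part, and hence
  improves itself to \<open>\<beta> n = O(A ^ n)\<close> for some \<open>A\<close> (\<open>perturbed_recurrence_geom_bounded\<close>). Conversely,
  if \<open>\<beta>\<close> decayed faster than a certain geometric sequence, then solving the recurrence backwards would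
  give a Gaussian decay (\<open>perturbed_recurrence_rapid_decay\<close>), which is excluded. So the infimum \<open>\<mu>\<close> of
  all \<open>A\<close> with \<open>\<beta> n = O(A ^ n)\<close> is positive.
  The perturbation is then \<open>O(\<delta> ^ n)\<close> for every \<open>\<delta> > \<eta> * \<mu>\<close>, and \<open>\<beta>\<close> solves a recurrence with constant
  coefficients up to this error. Such a sequence is an exponential polynomial plus \<open>O(\<delta> ^ n)\<close>
  (\<open>exponential_polynomial_asymptotics\<close>). If \<open>\<delta> < \<mu>\<close> exceeds the modulus of every root that is smaller than
  \<open>\<mu>\<close>, then only roots of modulus \<open>\<mu>\<close> can occur, and one of them does, by minimality of \<open>\<mu>\<close>.
\<close>

section \<open>Geometrically bounded sequences\<close>

text \<open>
  For \<open>A > 0\<close> this is \<open>x \<in> O(\<lambda>n. A ^ n)\<close>, but with a bound that holds for all \<open>n\<close>, so that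
  inductions can start at 0.
\<close>
definition geom_bounded :: "real \<Rightarrow> (nat \<Rightarrow> complex) \<Rightarrow> bool" where
  "geom_bounded A x \<longleftrightarrow> (\<exists>C. \<forall>n. norm (x n) \<le> C * A ^ n)"

lemma eventually_bound_imp_bound:
  fixes g :: "nat \<Rightarrow> real" and x :: "nat \<Rightarrow> complex"
  assumes "\<And>n. n \<ge> n0 \<Longrightarrow> norm (x n) \<le> g n" "\<And>n. 0 < g n"
  shows "\<exists>K. \<forall>n. norm (x n) \<le> K * g n"
proof -
  define K where "K = 1 + (\<Sum>n<n0. norm (x n) / g n)"
  have nn: "0 \<le> norm (x n) / g n" for n using assms(2)[of n] by simp
  have "norm (x n) \<le> K * g n" for n
  proof (cases "n < n0")
    case True
    then have "norm (x n) / g n \<le> (\<Sum>n<n0. norm (x n) / g n)" using nn by (intro member_le_sum) auto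
    then have "norm (x n) / g n \<le> K" unfolding K_def by simp
    then show ?thesis using assms(2)[of n] by (simp add: pos_divide_le_eq)
  next
    case False
    have "1 \<le> K" unfolding K_def using nn by (simp add: sum_nonneg)
    then have "1 * g n \<le> K * g n" using assms(2)[of n] by (intro mult_right_mono) auto
    then show ?thesis using assms(1)[of n] False by simp
  qed
  then show ?thesis by blast
qed

lemma geom_bounded_eventually:
  assumes "A > 0" "\<forall>n\<ge>n0. norm (x n) \<le> C * A ^ n"
  shows "geom_bounded A x"
proof -
  have "\<exists>K. \<forall>n. norm (x n) \<le> K * ((\<bar>C\<bar> + 1) * A ^ n)"
  proof (rule eventually_bound_imp_bound)
    fix n assume "n \<ge> n0"
    then have "norm (x n) \<le> C * A ^ n" using assms(2) by blast
    also have "\<dots> \<le> (\<bar>C\<bar> + 1) * A ^ n" using assms(1) by (intro mult_right_mono) auto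
    finally show "norm (x n) \<le> (\<bar>C\<bar> + 1) * A ^ n" .
  qed (use assms(1) in auto)
  then show ?thesis unfolding geom_bounded_def by (metis mult.assoc)
qed

lemma geom_bounded_iff_bigo:
  assumes "A > 0"
  shows "geom_bounded A x \<longleftrightarrow> x \<in> O(\<lambda>n. of_real A ^ n)"
proof
  assume "geom_bounded A x"
  then obtain C where "\<And>n. norm (x n) \<le> C * A ^ n" unfolding geom_bounded_def by blast
  then show "x \<in> O(\<lambda>n. of_real A ^ n)"
    using assms by (intro bigoI[of _ C]) (simp add: norm_power)
next
  assume "x \<in> O(\<lambda>n. of_real A ^ n)"
  then obtain C where "eventually (\<lambda>n. norm (x n) \<le> C * A ^ n) sequentially"
    using assms by (auto elim!: landau_o.bigE simp: norm_power)
  then show "geom_bounded A x"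
    using geom_bounded_eventually[OF assms] unfolding eventually_sequentially by blast
qed

lemma geom_bounded_mono:
  assumes "geom_bounded A x" "0 < A" "A \<le> B"
  shows "geom_bounded B x"
proof -
  obtain C where C: "\<And>n. norm (x n) \<le> C * A ^ n" using assms(1) unfolding geom_bounded_def by blast
  have "C \<ge> 0" using order_trans[OF norm_ge_zero C[of 0]] by simp
  then have "norm (x n) \<le> C * B ^ n" for n
    using assms by (intro order_trans[OF C] mult_left_mono power_mono) auto
  then show ?thesis unfolding geom_bounded_def by blast
qed

lemma geom_bounded_0: "geom_bounded A (\<lambda>n. 0)"
  unfolding geom_bounded_def by (rule exI[of _ 0]) simp

lemma geom_bounded_add:
  assumes "geom_bounded A x" "geom_bounded A y"
  shows "geom_bounded A (\<lambda>n. x n + y n)"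
proof -
  obtain C D where "\<And>n. norm (x n) \<le> C * A ^ n" "\<And>n. norm (y n) \<le> D * A ^ n"
    using assms unfolding geom_bounded_def by blast
  then have "norm (x n + y n) \<le> (C + D) * A ^ n" for n
    by (intro order_trans[OF norm_triangle_ineq]) (simp add: distrib_right add_mono)
  then show ?thesis unfolding geom_bounded_def by blast
qed

lemma geom_bounded_cmult:
  assumes "geom_bounded A x"
  shows "geom_bounded A (\<lambda>n. c * x n)"
proof -
  obtain C where "\<And>n. norm (x n) \<le> C * A ^ n" using assms unfolding geom_bounded_def by blast
  then have "norm (c * x n) \<le> (norm c * C) * A ^ n" for n
    by (simp add: norm_mult mult.assoc mult_left_mono)
  then show ?thesis unfolding geom_bounded_def by blast
qed

lemma geom_bounded_diff:
  assumes "geom_bounded A x" "geom_bounded A y"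
  shows "geom_bounded A (\<lambda>n. x n - y n)"
  using geom_bounded_add[OF assms(1) geom_bounded_cmult[OF assms(2), of "-1"]] by simp

lemma geom_bounded_sum:
  assumes "\<And>i. i \<in> I \<Longrightarrow> geom_bounded A (x i)"
  shows "geom_bounded A (\<lambda>n. \<Sum>i\<in>I. x i n)"
  using assms by (induction I rule: infinite_finite_induct)
    (auto intro!: geom_bounded_add simp: geom_bounded_0)

lemma geom_bounded_shift:
  assumes "geom_bounded A x"
  shows "geom_bounded A (\<lambda>n. x (n + k))"
proof -
  obtain C where "\<And>n. norm (x n) \<le> C * A ^ n" using assms unfolding geom_bounded_def by blast
  then have "norm (x (n + k)) \<le> C * A ^ (n + k)" for n by blast
  moreover have "C * A ^ (n + k) = (C * A ^ k) * A ^ n" for n by (simp add: power_add)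
  ultimately have "norm (x (n + k)) \<le> (C * A ^ k) * A ^ n" for n by metis
  then show ?thesis unfolding geom_bounded_def by blast
qed

lemma geom_bounded_unshift:
  assumes "geom_bounded A (\<lambda>n. x (n + k))" "A > 0"
  shows "geom_bounded A x"
proof -
  obtain C where C: "\<And>n. norm (x (n + k)) \<le> C * A ^ n" using assms unfolding geom_bounded_def by blast
  have "norm (x n) \<le> (C / A ^ k) * A ^ n" if "n \<ge> k" for n
    using C[of "n - k"] that assms(2) by (simp add: power_diff)
  then show ?thesis using geom_bounded_eventually[OF assms(2)] by blast
qed

lemma geom_bounded_power: "norm w \<le> A \<Longrightarrow> geom_bounded A (\<lambda>n. w ^ n)"
  unfolding geom_bounded_def by (rule exI[of _ 1]) (simp add: norm_power power_mono)

lemma geom_bounded_times_n: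
  assumes "geom_bounded A x" "0 < A" "A < B"
  shows "geom_bounded B (\<lambda>n. of_nat n * x n)"
proof -
  obtain C where C: "\<And>n. norm (x n) \<le> C * A ^ n" using assms(1) unfolding geom_bounded_def by blast
  have "C \<ge> 0" using order_trans[OF norm_ge_zero C[of 0]] by simp
  have "(\<lambda>n. of_nat n * (A / B) ^ n) \<longlonglongrightarrow> 0"
    using assms by (intro powser_times_n_limit_0) auto
  then have "Bseq (\<lambda>n. of_nat n * (A / B) ^ n)" by (rule convergent_imp_Bseq[OF convergentI])
  then obtain D where "\<And>n. norm (of_nat n * (A / B) ^ n) \<le> D" unfolding Bseq_def by blast
  then have D: "of_nat n * (A / B) ^ n \<le> D" for n
    using abs_le_D1 unfolding real_norm_def by blast
  have "norm (of_nat n * x n) \<le> (C * D) * B ^ n" for n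
  proof -
    have "norm (of_nat n * x n) \<le> real n * (C * A ^ n)"
      by (simp add: norm_mult C mult_left_mono)
    also have "\<dots> = C * (real n * (A / B) ^ n) * B ^ n"
      using assms by (simp add: power_divide)
    also have "\<dots> \<le> C * D * B ^ n"
      using assms D[of n] \<open>C \<ge> 0\<close> by (intro mult_right_mono mult_left_mono) auto
    finally show ?thesis .
  qed
  then show ?thesis unfolding geom_bounded_def by blast
qed

text \<open>
  Each factor \<open>n\<close> costs an arbitrarily small increase of the base, so the degree of \<open>Q\<close> is absorbed
  by the gap between \<open>norm w\<close> and \<open>A\<close>.
\<close>
lemma geom_bounded_poly_times_power:
  assumes "norm w < A"
  shows "geom_bounded A (\<lambda>n. poly Q (of_nat n) * w ^ n)"
  using assms
proof (induction Q arbitrary: A rule: pCons_induct)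
  case 0
  then show ?case by (simp add: geom_bounded_0)
next
  case (pCons a p)
  obtain B where B: "norm w < B" "B < A" using pCons.prems dense by blast
  have "0 < B" using B(1) norm_ge_zero[of w] by linarith
  have "geom_bounded A (\<lambda>n. of_nat n * (poly p (of_nat n) * w ^ n))"
    by (rule geom_bounded_times_n[OF pCons.IH[OF B(1)] \<open>0 < B\<close> B(2)])
  from geom_bounded_add[OF this geom_bounded_cmult[OF geom_bounded_power, of w A a]] show ?case
    using pCons.prems by (simp add: algebra_simps)
qed


section \<open>Linear recurrences and exponential polynomials\<close>

text \<open>
  The operator \<open>R(E)\<close>, where \<open>E\<close> is the shift \<open>(E x) n = x (n + 1)\<close>. Thus \<open>shift_op R x = 0\<close> is the linear
  recurrence with characteristic polynomial \<open>R\<close>.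
\<close>
definition shift_op :: "complex poly \<Rightarrow> (nat \<Rightarrow> complex) \<Rightarrow> nat \<Rightarrow> complex" where
  "shift_op R x n = (\<Sum>i\<le>degree R. coeff R i * x (n + i))"

lemma shift_op_eq_sum:
  assumes "degree R \<le> d"
  shows "shift_op R x n = (\<Sum>i\<le>d. coeff R i * x (n + i))"
  unfolding shift_op_def using assms
  by (intro sum.mono_neutral_left) (auto simp: coeff_eq_0)

text \<open>
  The instance of \<open>(P * R)(E) = R(E) \<circ> P(E)\<close> that allows inductions over the linear factors of a polynomial.
\<close>
lemma shift_op_linear_factor:
  "shift_op ([:-w, 1:] * R) x n = shift_op R (\<lambda>n. x (Suc n) - w * x n) n"
proof -
  let ?d = "Suc (degree R)"
  have deg: "degree ([:-w, 1:] * R) \<le> ?d"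
    by (rule order_trans[OF degree_mult_le]) simp
  have c: "coeff ([:-w, 1:] * R) i = (case i of 0 \<Rightarrow> 0 | Suc j \<Rightarrow> coeff R j) - w * coeff R i" for i
    by (simp add: coeff_pCons split: nat.splits)
  have "shift_op ([:-w, 1:] * R) x n =
      (\<Sum>i\<le>?d. (case i of 0 \<Rightarrow> 0 | Suc j \<Rightarrow> coeff R j) * x (n + i)) - w * (\<Sum>i\<le>?d. coeff R i * x (n + i))"
    unfolding shift_op_eq_sum[OF deg] c
    by (simp only: sum_subtractf sum_distrib_left left_diff_distrib mult.assoc)
  also have "(\<Sum>i\<le>?d. (case i of 0 \<Rightarrow> 0 | Suc j \<Rightarrow> coeff R j) * x (n + i)) = (\<Sum>i\<le>degree R. coeff R i * x (Suc (n + i)))"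
    by (subst sum.atMost_Suc_shift) simp
  also have "(\<Sum>i\<le>?d. coeff R i * x (n + i)) = (\<Sum>i\<le>degree R. coeff R i * x (n + i))"
    by (simp add: coeff_eq_0)
  finally show ?thesis
    unfolding shift_op_def by (simp add: sum_subtractf sum_distrib_left right_diff_distrib algebra_simps)
qed

lemma shift_op_diff: "shift_op R (\<lambda>n. x n - y n) n = shift_op R x n - shift_op R y n"
  unfolding shift_op_def by (simp add: right_diff_distrib sum_subtractf)

text \<open>
  If \<open>norm w < \<delta>\<close>, the recurrence is stable and the inhomogeneity determines the size of \<open>e\<close>. If
  \<open>norm w > \<delta>\<close>, then \<open>e n / w ^ n\<close> has geometrically small increments, so it converges to a limit \<open>c\<close>
  at a geometric rate. For \<open>norm w = \<delta>\<close> there is resonance and neither argument applies.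
\<close>
lemma first_order_asymptotics:
  fixes e :: "nat \<Rightarrow> complex"
  assumes "0 < \<delta>" "norm w \<noteq> \<delta>" and g: "geom_bounded \<delta> (\<lambda>n. e (Suc n) - w * e n)"
  obtains c where "norm w < \<delta> \<longrightarrow> c = 0" "geom_bounded \<delta> (\<lambda>n. e n - c * w ^ n)"
proof -
  obtain C where C: "\<And>n. norm (e (Suc n) - w * e n) \<le> C * \<delta> ^ n"
    using g unfolding geom_bounded_def by blast
  have "C \<ge> 0" using order_trans[OF norm_ge_zero C[of 0]] by simp
  show thesis
  proof (cases "norm w < \<delta>")
    case True
    \<comment> \<open>The summand \<open>C / (\<delta> - norm w)\<close> solves \<open>norm w * D + C = \<delta> * D\<close>, the condition for the induction step.\<close>
    define D where "D = norm (e 0) + C / (\<delta> - norm w)"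
    have D: "norm w * D + C \<le> \<delta> * D"
    proof -
      have "C / (\<delta> - norm w) \<le> D" unfolding D_def by simp
      then have "C \<le> D * (\<delta> - norm w)" using True by (simp add: pos_divide_le_eq)
      then show ?thesis by (simp add: algebra_simps)
    qed
    have "norm (e n) \<le> D * \<delta> ^ n" for n
    proof (induction n)
      case 0
      then show ?case using True \<open>C \<ge> 0\<close> by (simp add: D_def)
    next
      case (Suc n)
      have "norm (e (Suc n)) \<le> norm (e (Suc n) - w * e n) + norm w * norm (e n)"
        by (metis add.commute diff_add_cancel norm_mult norm_triangle_ineq)
      also have "\<dots> \<le> C * \<delta> ^ n + norm w * (D * \<delta> ^ n)"
        using C Suc by (intro add_mono mult_left_mono) auto
      also have "\<dots> = (norm w * D + C) * \<delta> ^ n" by (simp add: algebra_simps)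
      also have "\<dots> \<le> (\<delta> * D) * \<delta> ^ n" using D assms(1) by (intro mult_right_mono) auto
      finally show ?case by (simp add: mult_ac)
    qed
    then have "geom_bounded \<delta> (\<lambda>n. e n - 0 * w ^ n)" unfolding geom_bounded_def by auto
    then show thesis using that by blast
  next
    case False
    then have w: "norm w > \<delta>" using assms(2) by linarith
    then have "w \<noteq> 0" using assms(1) by auto
    define t where "t = \<delta> / norm w"
    have "0 < norm w" using w assms(1) by linarith
    then have t: "0 < t" "t < 1" using w assms(1) by (simp_all add: t_def pos_divide_less_eq)
    \<comment> \<open>With \<open>u n = e n / w ^ n\<close> the recurrence says that the increments of \<open>u\<close> are geometrically small.\<close>
    define d where "d n = e (Suc n) / w ^ Suc n - e n / w ^ n" for n
    define C' where "C' = C / norm w"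
    have d: "norm (d n) \<le> C' * t ^ n" for n
    proof -
      have "d n = (e (Suc n) - w * e n) / w ^ Suc n" unfolding d_def using \<open>w \<noteq> 0\<close>
        by (simp add: diff_divide_distrib)
      then have "norm (d n) = norm (e (Suc n) - w * e n) / norm w ^ Suc n"
        by (simp add: norm_divide norm_power norm_mult)
      also have "\<dots> \<le> C * \<delta> ^ n / norm w ^ Suc n" by (intro divide_right_mono C) auto
      also have "\<dots> = C' * t ^ n" unfolding t_def C'_def by (simp add: power_divide)
      finally show ?thesis .
    qed
    have sumb: "summable (\<lambda>n. C' * t ^ n)" using t by (intro summable_mult summable_geometric) auto
    have sumd: "summable d" by (rule summable_comparison_test'[OF sumb, of 0]) (use d in auto)
    define c where "c = e 0 + suminf d"
    have part: "e n / w ^ n = e 0 + (\<Sum>i<n. d i)" for n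
      unfolding d_def by (subst sum_lessThan_telescope) simp
    have "norm (e n - c * w ^ n) \<le> (C' / (1 - t)) * \<delta> ^ n" for n
    proof -
      have sh: "summable (\<lambda>i. norm (d (i + n)))"
        by (rule summable_comparison_test'[OF summable_ignore_initial_segment[OF sumb, of n], of 0]) (use d in auto)
      have "c - e n / w ^ n = (\<Sum>i. d (i + n))"
        unfolding part c_def using suminf_split_initial_segment[OF sumd, of n] by simp
      also have "norm \<dots> \<le> (\<Sum>i. norm (d (i + n)))" by (rule summable_norm[OF sh])
      also have "\<dots> \<le> (\<Sum>i. C' * t ^ (i + n))"
        by (intro suminf_le d sh summable_ignore_initial_segment[OF sumb])
      also have "\<dots> = C' * t ^ n / (1 - t)"
        using t suminf_mult[OF summable_geometric[of t], of "C' * t ^ n"] suminf_geometric[of t]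
        by (simp add: power_add mult_ac)
      finally have "norm (c - e n / w ^ n) * norm w ^ n \<le> C' * t ^ n / (1 - t) * norm w ^ n"
        by (intro mult_right_mono) auto
      moreover have "norm (e n - c * w ^ n) = norm (c - e n / w ^ n) * norm w ^ n"
        using \<open>w \<noteq> 0\<close> by (simp add: norm_power[symmetric] norm_mult[symmetric] left_diff_distrib norm_minus_commute)
      moreover have "C' * t ^ n / (1 - t) * norm w ^ n = C' / (1 - t) * \<delta> ^ n"
        using \<open>w \<noteq> 0\<close> unfolding t_def by (simp add: power_divide)
      ultimately show ?thesis by metis
    qed
    then have "geom_bounded \<delta> (\<lambda>n. e n - c * w ^ n)" unfolding geom_bounded_def by blast
    then show thesis using that False by blast
  qed
qed

lemma power_not_geom_bounded:
  assumes "0 < A" "A < norm w" "geom_bounded A (\<lambda>n. c * w ^ n)"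
  shows "c = 0"
proof (rule ccontr)
  assume "c \<noteq> 0"
  obtain C where C: "\<And>n. norm (c * w ^ n) \<le> C * A ^ n" using assms(3) unfolding geom_bounded_def by blast
  have "(norm w / A) ^ n \<le> C / norm c" for n
    using C[of n] assms \<open>c \<noteq> 0\<close> by (simp add: norm_mult norm_power power_divide field_simps)
  moreover obtain n where "(norm w / A) ^ n > C / norm c"
    using assms real_arch_pow[of "norm w / A"] by auto
  ultimately show False by (meson not_le)
qed

text \<open>
  With \<open>x = n\<close> the equation says that \<open>Q(n) * v ^ n\<close> solves \<open>y (n + 1) - w * y n = P(n) * v ^ n\<close>. The operator
  on polynomials preserves the degree if \<open>v \<noteq> w\<close>; it lowers the degree by one if \<open>v = w\<close>, being then a
  multiple of the forward difference. So the leading term can be matched by a monomial, and the rest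
  has smaller degree.
\<close>
lemma poly_particular_solution:
  fixes v w :: complex
  assumes "v \<noteq> 0"
  shows "\<exists>Q. (Q \<noteq> 0 \<longrightarrow> P \<noteq> 0 \<and> degree Q \<le> degree P + (if v = w then 1 else 0)) \<and>
             (\<forall>x. v * poly Q (x + 1) - w * poly Q x = poly P x)"
proof (induction "if P = 0 then 0 else Suc (degree P)" arbitrary: P rule: less_induct)
  case less
  show ?case
  proof (cases "P = 0")
    case True
    then show ?thesis by (intro exI[of _ 0]) auto
  next
    case False
    define k where "k = degree P + (if v = w then 1 else 0)"
    \<comment> \<open>The operator maps \<open>x ^ k\<close> to a polynomial with leading coefficient \<open>v - w\<close>, or \<open>w * k\<close> if \<open>v = w\<close>.\<close>
    define c where "c = lead_coeff P / (if v = w then w * of_nat k else v - w)"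
    have dpos: "(if v = w then w * of_nat k else v - w) \<noteq> 0" using assms by (auto simp: k_def simp del: of_nat_Suc of_nat_add)
    define U where "U = monom c k"
    define L where "L = smult (v * c) ([:1, 1:] ^ k) - monom (w * c) k"
    have "coeff ([:1, 1:] ^ k) i = (of_nat (k choose i) :: complex)" for i
    proof (cases "i \<le> k")
      case True
      then show ?thesis by (simp add: coeff_linear_poly_power)
    next
      case False
      moreover have "degree ([:1, 1:] ^ k :: complex poly) \<le> k"
        using degree_power_le[of "[:1, 1:]" k] by simp
      ultimately show ?thesis by (simp add: coeff_eq_0)
    qed
    then have coeffL: "coeff L i = c * (v * of_nat (k choose i) - (if i = k then w else 0))" for i
      unfolding L_def by (simp add: algebra_simps)
    have topcoeff: "coeff L (degree P) = lead_coeff P"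
    proof (cases "v = w")
      case True
      then show ?thesis unfolding coeffL k_def using dpos by (simp add: c_def k_def)
    next
      case False
      then show ?thesis unfolding coeffL k_def using dpos by (simp add: c_def k_def)
    qed
    have degL: "coeff L i = 0" if "i > degree P" for i
    proof (cases "i = k")
      case True
      then show ?thesis using that unfolding coeffL k_def by (auto split: if_splits)
    next
      case False
      then have "i > k" using that unfolding k_def by (auto split: if_splits)
      then show ?thesis unfolding coeffL by simp
    qed
    define P' where "P' = P - L"
    have small: "P' = 0 \<or> degree P' < degree P"
    proof (rule ccontr)
      assume a: "\<not> ?thesis"
      have "coeff P' i = 0" if "i \<ge> degree P" for i
        using topcoeff degL[of i] that unfolding P'_def
        by (cases "i = degree P") (auto simp: coeff_eq_0)
      then show False using a leading_coeff_0_iff[of P'] by fastforce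
    qed
    then have "(if P' = 0 then 0 else Suc (degree P')) < (if P = 0 then 0 else Suc (degree P))"
      using False by auto
    from less.hyps[OF this] obtain Q' where Q':
      "Q' \<noteq> 0 \<longrightarrow> P' \<noteq> 0 \<and> degree Q' \<le> degree P' + (if v = w then 1 else 0)"
      "\<And>x. v * poly Q' (x + 1) - w * poly Q' x = poly P' x" by blast
    have "degree (U + Q') \<le> k"
    proof (rule degree_add_le)
      show "degree U \<le> k" unfolding U_def by (rule degree_monom_le)
      show "degree Q' \<le> k" using Q'(1) small unfolding k_def by (cases "Q' = 0") auto
    qed
    moreover have "v * poly (U + Q') (x + 1) - w * poly (U + Q') x = poly P x" for x
    proof -
      have "v * poly U (x + 1) - w * poly U x = poly L x"
        unfolding L_def U_def by (simp add: poly_monom poly_power algebra_simps)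
      then show ?thesis using Q'(2)[of x] unfolding P'_def by (simp add: algebra_simps)
    qed
    ultimately show ?thesis using False unfolding k_def by blast
  qed
qed

definition exp_poly :: "complex poly \<Rightarrow> (complex \<Rightarrow> complex poly) \<Rightarrow> nat \<Rightarrow> complex" where
  "exp_poly R Q n = (\<Sum>w | poly R w = 0. poly (Q w) (of_nat n) * w ^ n)"

text \<open>
  The proof splits off one linear factor \<open>X - w\<close> of \<open>R\<close> at a time: the sequence \<open>(E - w) x\<close> has an expansion
  by induction, its main part is solved for explicitly, and \<open>first_order_asymptotics\<close> treats the rest.
  Solving can raise the degree only at the frequency \<open>w\<close>, exactly where the order of the root increases.
  The bounds on \<open>x\<close> exclude the frequencies beyond \<open>\<mu>\<close>. The exponential polynomial is required to be an exact
  solution, because then the error term satisfies the same hypotheses as \<open>x\<close>, and the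
  expansion can be continued with a smaller \<open>\<delta>\<close>.
\<close>
lemma exponential_polynomial_asymptotics:
  assumes "R \<noteq> 0" "0 < \<delta>" "\<delta> \<le> \<mu>" "\<And>w. poly R w = 0 \<Longrightarrow> norm w \<noteq> \<delta>"
    and "\<And>A. \<mu> < A \<Longrightarrow> geom_bounded A x" "geom_bounded \<delta> (shift_op R x)"
  shows "\<exists>Q. (\<forall>w. Q w \<noteq> 0 \<longrightarrow> degree (Q w) < order w R \<and> \<delta> < norm w \<and> norm w \<le> \<mu>) \<and>
             (\<forall>n. shift_op R (exp_poly R Q) n = 0) \<and> geom_bounded \<delta> (\<lambda>n. x n - exp_poly R Q n)"
  using assms
proof (induction "degree R" arbitrary: R x)
  case 0
  from \<open>0 = degree R\<close> obtain c where c: "R = [:c:]" by (metis degree_eq_zeroE)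
  then have "c \<noteq> 0" using 0 by auto
  have "geom_bounded \<delta> (\<lambda>n. inverse c * shift_op R x n)" by (rule geom_bounded_cmult) fact
  moreover have "inverse c * shift_op R x n = x n" for n
    unfolding c shift_op_def using \<open>c \<noteq> 0\<close> by simp
  ultimately show ?case
    by (intro exI[of _ "\<lambda>_. 0"]) (simp add: exp_poly_def shift_op_def)
next
  case (Suc d)
  obtain w where w: "poly R w = 0"
    using alg_closed_imp_poly_has_root[of R] Suc.hyps(2) by auto
  then obtain R' where R': "R = [:-w, 1:] * R'" by (metis dvdE poly_eq_0_iff_dvd)
  have nz: "R' \<noteq> 0" using R' Suc.prems(1) by auto
  have degR': "d = degree R'"
  proof -
    have "degree R = degree [:-w, 1:] + degree R'" unfolding R' by (rule degree_mult_eq) (use nz in auto)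
    then show ?thesis using Suc.hyps(2) by simp
  qed
  have order: "order v R = (if v = w then 1 else 0) + order v R'" for v
  proof -
    have "order v R = order v [:-w, 1:] + order v R'"
      unfolding R' by (rule order_mult) (use R' Suc.prems(1) in metis)
    moreover have "order v [:-w, 1:] = (if v = w then 1 else 0)"
      using order_power_n_n[of w 1] by (auto intro: order_0I)
    ultimately show ?thesis by simp
  qed
  define y where "y n = x (Suc n) - w * x n" for n
  have y: "shift_op R x = shift_op R' y" unfolding R' y_def by (rule ext) (rule shift_op_linear_factor)
  have "geom_bounded A y" if "\<mu> < A" for A
    unfolding y_def using Suc.prems(5)[OF that] geom_bounded_shift[of A x 1]
    by (intro geom_bounded_diff geom_bounded_cmult) auto
  from Suc.hyps(1)[OF degR' nz Suc.prems(2,3) _ this] obtain Q where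
    Q: "\<And>v. Q v \<noteq> 0 \<Longrightarrow> degree (Q v) < order v R' \<and> \<delta> < norm v \<and> norm v \<le> \<mu>"
    and hom: "\<And>n. shift_op R' (exp_poly R' Q) n = 0"
    and yQ: "geom_bounded \<delta> (\<lambda>n. y n - exp_poly R' Q n)"
    using Suc.prems(4,6) unfolding y unfolding R' by auto
  have "\<exists>Q1. (Q1 \<noteq> 0 \<longrightarrow> Q v \<noteq> 0 \<and> degree Q1 \<le> degree (Q v) + (if v = w then 1 else 0)) \<and>
             (\<forall>x. v * poly Q1 (x + 1) - w * poly Q1 x = poly (Q v) x)" for v
  proof (cases "Q v = 0")
    case True
    then show ?thesis by (intro exI[of _ 0]) auto
  next
    case False
    then have "v \<noteq> 0" using Q[of v] Suc.prems(2) by auto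
    then show ?thesis by (rule poly_particular_solution)
  qed
  then obtain Q1 where
    Q1: "\<And>v. Q1 v \<noteq> 0 \<Longrightarrow> Q v \<noteq> 0 \<and> degree (Q1 v) \<le> degree (Q v) + (if v = w then 1 else 0)"
    and Q1eq: "\<And>v x. v * poly (Q1 v) (x + 1) - w * poly (Q1 v) x = poly (Q v) x"
    by metis
  have part: "exp_poly R' Q1 (Suc n) - w * exp_poly R' Q1 n = exp_poly R' Q n" for n
  proof -
    have "exp_poly R' Q1 (Suc n) - w * exp_poly R' Q1 n =
        (\<Sum>v | poly R' v = 0. (v * poly (Q1 v) (of_nat n + 1) - w * poly (Q1 v) (of_nat n)) * v ^ n)"
      unfolding exp_poly_def by (simp add: sum_distrib_left sum_subtractf algebra_simps)
    then show ?thesis unfolding Q1eq exp_poly_def .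
  qed
  \<comment> \<open>\<open>exp_poly R' Q1\<close> solves the first-order equation for the main part, so \<open>e\<close> satisfies it up to \<open>O(\<delta> ^ n)\<close>.\<close>
  define e where "e n = x n - exp_poly R' Q1 n" for n
  have "(\<lambda>n. e (Suc n) - w * e n) = (\<lambda>n. y n - exp_poly R' Q n)"
    unfolding e_def y_def part[symmetric] by (rule ext) (simp add: algebra_simps)
  then have "geom_bounded \<delta> (\<lambda>n. e (Suc n) - w * e n)" using yQ by simp
  from first_order_asymptotics[OF Suc.prems(2) Suc.prems(4)[OF w] this] obtain c where
    c: "norm w < \<delta> \<longrightarrow> c = 0" "geom_bounded \<delta> (\<lambda>n. e n - c * w ^ n)" by blast
  have c_large: "c = 0" if "norm w > \<mu>"
  proof -
    obtain A where A: "\<mu> < A" "A < norm w" using \<open>norm w > \<mu>\<close> dense by blast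
    have A0: "0 < A" "\<delta> \<le> A" using A Suc.prems(2,3) by linarith+
    have "geom_bounded A (exp_poly R' Q1)" unfolding exp_poly_def
    proof (rule geom_bounded_sum)
      fix v assume "v \<in> {v. poly R' v = 0}"
      show "geom_bounded A (\<lambda>n. poly (Q1 v) (of_nat n) * v ^ n)"
      proof (cases "Q1 v = 0")
        case True
        then show ?thesis by (simp add: geom_bounded_0)
      next
        case False
        then have "norm v < A" using Q1[of v] Q[of v] A(1) by simp
        then show ?thesis by (rule geom_bounded_poly_times_power)
      qed
    qed
    then have "geom_bounded A e" unfolding e_def by (intro geom_bounded_diff Suc.prems(5) A)
    from geom_bounded_diff[OF this geom_bounded_mono[OF c(2) Suc.prems(2) A0(2)]]
    have "geom_bounded A (\<lambda>n. c * w ^ n)" by simp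
    then show "c = 0" by (rule power_not_geom_bounded[OF A0(1) A(2)])
  qed
  have cw: "\<delta> < norm w \<and> norm w \<le> \<mu>" if "c \<noteq> 0"
    using that c(1) c_large Suc.prems(4)[OF w] by linarith
  define Q2 where "Q2 v = Q1 v + (if v = w then [:c:] else 0)" for v
  have Z: "{v. poly R v = 0} = insert w {v. poly R' v = 0}" unfolding R' by auto
  have Q1w: "Q1 w = 0" if "poly R' w \<noteq> 0"
    using that Q1[of w] Q[of w] by (auto simp: order_0I)
  have Q2: "exp_poly R Q2 n = exp_poly R' Q1 n + c * w ^ n" for n
  proof -
    have fin: "finite {v. poly R v = 0}" using Suc.prems(1) poly_roots_finite by blast
    have "exp_poly R Q2 n = (\<Sum>v | poly R v = 0. poly (Q1 v) (of_nat n) * v ^ n + (if v = w then c * v ^ n else 0))"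
      unfolding exp_poly_def Q2_def by (intro sum.cong refl) (auto simp: algebra_simps)
    also have "\<dots> = (\<Sum>v | poly R v = 0. poly (Q1 v) (of_nat n) * v ^ n) + c * w ^ n"
      using fin w by (simp add: sum.distrib sum.delta')
    also have "(\<Sum>v | poly R v = 0. poly (Q1 v) (of_nat n) * v ^ n) = exp_poly R' Q1 n"
      unfolding exp_poly_def using fin Q1w by (intro sum.mono_neutral_right) (auto simp: Z)
    finally show ?thesis .
  qed
  show ?case
  proof (intro exI[of _ Q2] conjI allI impI)
    fix v assume v: "Q2 v \<noteq> 0"
    then have "Q1 v \<noteq> 0 \<or> (v = w \<and> c \<noteq> 0)" unfolding Q2_def by (auto split: if_splits)
    then show "\<delta> < norm v" "norm v \<le> \<mu>" using Q1 Q cw by blast+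
    show "degree (Q2 v) < order v R"
    proof (cases "Q1 v = 0")
      case True
      then show ?thesis using v unfolding Q2_def order by (auto split: if_splits)
    next
      case False
      have "degree (Q2 v) \<le> max (degree (Q1 v)) 0" unfolding Q2_def
        by (rule order_trans[OF degree_add_le_max]) auto
      then show ?thesis using Q1[OF False] Q[of v] unfolding order by auto
    qed
  next
    fix n
    have "(\<lambda>n. exp_poly R Q2 (Suc n) - w * exp_poly R Q2 n) = exp_poly R' Q"
      unfolding Q2 part[symmetric] by (rule ext) (simp add: algebra_simps)
    then show "shift_op R (exp_poly R Q2) n = 0"
      unfolding R' shift_op_linear_factor unfolding R'[symmetric] using hom by simp
  next
    show "geom_bounded \<delta> (\<lambda>n. x n - exp_poly R Q2 n)"
      using c(2) unfolding Q2 e_def by (simp add: algebra_simps)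
  qed
qed

section \<open>Recurrences with a geometrically small two-sided perturbation\<close>

text \<open>
  The main part \<open>shift_op R x (n + H)\<close> starts at the middle of the window from \<open>n\<close> to \<open>n + 2 * H\<close>: the
  perturbation may involve terms before and after it.
\<close>
definition perturbed_recurrence :: "complex poly \<Rightarrow> real \<Rightarrow> nat \<Rightarrow> (nat \<Rightarrow> complex) \<Rightarrow> bool" where
  "perturbed_recurrence R \<eta> H x \<longleftrightarrow>
     (\<exists>C n0. \<forall>n\<ge>n0. norm (shift_op R x (n + H)) \<le> C * \<eta> ^ n * (\<Sum>i\<le>2*H. norm (x (n + i))))"

text \<open>
  Iteration halves the bound until it reaches \<open>K\<close>. In the applications \<open>P S\<close> says that a
  sequence is bounded by \<open>S\<close> times a fixed weight.
\<close>
lemma self_improving_bound: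
  fixes P :: "real \<Rightarrow> bool"
  assumes "P S" "0 < K" "\<And>S. S \<ge> K \<Longrightarrow> P S \<Longrightarrow> P (max K (S / 2))" "\<And>S T. S \<le> T \<Longrightarrow> P S \<Longrightarrow> P T"
  shows "P K"
proof -
  have iter: "P (max K (S / 2 ^ j))" for j
  proof (induction j)
    case 0
    then show ?case using assms(4)[OF _ assms(1)] by simp
  next
    case (Suc j)
    have "P (max K (max K (S / 2 ^ j) / 2))" using assms(3)[OF _ Suc] by simp
    moreover have "max K (max K (S / 2 ^ j) / 2) \<le> max K (S / 2 ^ Suc j)"
      using assms(2) by (simp add: max_def)
    ultimately show ?case using assms(4) by blast
  qed
  obtain j where "S / K < 2 ^ j" using real_arch_pow[of 2] by auto
  then have "S / 2 ^ j \<le> K" using assms(2) by (simp add: field_simps)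
  then show ?thesis using iter[of j] by (simp add: max_absorb1)
qed

lemma eventually_const_times_power_le:
  fixes K x c :: real
  assumes "0 \<le> x" "x < 1" "0 < c"
  obtains n0 where "\<And>n. n \<ge> n0 \<Longrightarrow> K * x ^ n \<le> c"
proof -
  have "(\<lambda>n. K * x ^ n) \<longlonglongrightarrow> K * 0"
    using assms by (intro tendsto_mult tendsto_const LIMSEQ_power_zero) auto
  then have "eventually (\<lambda>n. K * x ^ n < c) sequentially"
    using assms(3) by (intro order_tendstoD) auto
  then show thesis using that unfolding eventually_sequentially by (meson less_imp_le)
qed

lemma small_exponent_exists:
  fixes \<eta> :: real
  assumes "0 < \<eta>" "\<eta> < 1"
  obtains \<epsilon> where "0 < \<epsilon>" "\<eta> * exp (\<epsilon> * real k) < 1"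
proof -
  define \<epsilon> where "\<epsilon> = - ln \<eta> / (real k + 1)"
  have "ln \<eta> < 0" using assms by simp
  then have e: "0 < \<epsilon>" unfolding \<epsilon>_def by (intro divide_pos_pos) auto
  have "\<epsilon> * real k < \<epsilon> * (real k + 1)" using e by simp
  also have "\<dots> = - ln \<eta>" unfolding \<epsilon>_def by simp
  finally have "\<eta> * exp (\<epsilon> * real k) < \<eta> * exp (- ln \<eta>)" using assms by simp
  also have "\<dots> = 1" using assms by (simp add: exp_minus)
  finally show thesis using that e by blast
qed

text \<open>
  The recurrence is solved for its last main term. In the weighted norm given by \<open>A ^ n\<close> with a large
  \<open>A\<close> the earlier main terms contribute at most a quarter. The perturbation reaches up to \<open>2 * H\<close> steps
  ahead, where \<open>exp (\<epsilon> * n\<^sup>2)\<close> has grown by a factor of about \<open>exp (4 * \<epsilon> * H * n)\<close>; for small \<open>\<epsilon>\<close> the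
  factor \<open>\<eta> ^ n\<close> beats this and the perturbation contributes at most another quarter. So any bound
  by a multiple of the weight \<open>A ^ n * (1 + \<tau> * exp (\<epsilon> * n\<^sup>2))\<close> can be halved, down to a constant independent
  of \<open>\<tau>\<close>. The hypothesis provides some bound of this kind for each \<open>\<tau> > 0\<close>, and \<open>\<tau>\<close> tends to 0.
\<close>
lemma perturbed_recurrence_geom_bounded:
  assumes "R \<noteq> 0" "0 < \<eta>" "\<eta> < 1" and rec: "perturbed_recurrence R \<eta> H x"
    and sub: "\<And>\<epsilon>. \<epsilon> > 0 \<Longrightarrow> \<exists>K. \<forall>n. norm (x n) \<le> K * exp (\<epsilon> * (real n)\<^sup>2)"
  obtains A where "0 < A" "geom_bounded A x"
proof -
  define M where "M = degree R"
  define l where "l = norm (coeff R M)"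
  have l: "0 < l" unfolding l_def M_def using assms(1) by simp
  define B where "B = (\<Sum>i<M. norm (coeff R i))"
  obtain C0 n0 where C0: "\<And>n. n \<ge> n0 \<Longrightarrow>
      norm (shift_op R x (n + H)) \<le> C0 * \<eta> ^ n * (\<Sum>i\<le>2*H. norm (x (n + i)))"
    using rec unfolding perturbed_recurrence_def by blast
  define C where "C = \<bar>C0\<bar>"
  have C: "norm (shift_op R x (n + H)) \<le> C * \<eta> ^ n * (\<Sum>i\<le>2*H. norm (x (n + i)))" if "n \<ge> n0" for n
    unfolding C_def using assms(2)
    by (intro order_trans[OF C0[OF that]] mult_right_mono) (auto simp: sum_nonneg)
  have "C \<ge> 0" unfolding C_def by simp
  \<comment> \<open>Then \<open>B / A \<le> l / 4\<close>, so that the earlier main terms contribute at most a quarter.\<close>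
  define A where "A = max 1 (4 * B / l)"
  have A: "1 \<le> A" "4 * B / l \<le> A" unfolding A_def by auto
  then have BA: "B / A \<le> l / 4" using l by (simp add: field_simps)
  obtain \<epsilon> where \<epsilon>: "0 < \<epsilon>" "\<eta> * exp (\<epsilon> * real (4 * H)) < 1"
    using small_exponent_exists[OF assms(2,3)] by blast
  define E where "E n = exp (\<epsilon> * (real n)\<^sup>2)" for n :: nat
  have Emono: "E i \<le> E j" if "i \<le> j" for i j
    unfolding E_def using that \<epsilon>(1) by (simp add: power_mono)
  define x1 where "x1 = \<eta> * exp (\<epsilon> * real (4 * H))"
  define C1 where "C1 = C * real (2 * H + 1) * A ^ (2 * H) * exp (\<epsilon> * real (4 * H * H))"
  obtain n1' where n1': "\<And>n. n \<ge> n1' \<Longrightarrow> C1 * x1 ^ n \<le> l / 4"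
    using eventually_const_times_power_le[of x1 "l / 4" C1] \<epsilon>(2) assms(2) l unfolding x1_def by auto
  define n1 where "n1 = max n0 n1'"
  define n2 where "n2 = n1 + H + M"
  define K where "K = 1 + (\<Sum>n<n2. norm (x n))"
  have "K > 0" unfolding K_def by (intro add_pos_nonneg sum_nonneg) auto
  obtain K' where K': "\<And>n. norm (x n) \<le> K' * E n" using sub[OF \<epsilon>(1)] unfolding E_def by blast
  \<comment> \<open>Neither \<open>K\<close> nor \<open>n1\<close> depends on \<open>\<tau>\<close>; this is what allows the limit \<open>\<tau> \<rightarrow> 0\<close>.\<close>
  have main: "\<forall>n\<ge>n1. norm (x n) \<le> K * (A ^ n * (1 + \<tau> * E n))" if "\<tau> > 0" for \<tau>
  proof -
    define V where "V n = A ^ n * (1 + \<tau> * E n)" for n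
    have Vpos: "0 < V n" for n unfolding V_def E_def using A(1) \<open>\<tau> > 0\<close>
      by (intro mult_pos_pos add_pos_pos) auto
    have V1: "1 \<le> V n" for n
    proof -
      have "1 * 1 \<le> A ^ n * (1 + \<tau> * E n)"
        using A(1) \<open>\<tau> > 0\<close> by (intro mult_mono) (auto simp: E_def)
      then show ?thesis unfolding V_def by simp
    qed
    have Vstep: "V i * A \<le> V j" if "i < j" for i j
    proof -
      have "V i * A = A ^ Suc i * (1 + \<tau> * E i)" unfolding V_def by simp
      also have "\<dots> \<le> A ^ j * (1 + \<tau> * E j)"
        using that A(1) \<open>\<tau> > 0\<close> Emono[of i j] by (intro mult_mono power_increasing) (auto simp: E_def)
      finally show ?thesis unfolding V_def .
    qed
    have Vmono: "V i \<le> V j" if "i \<le> j" for i j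
      unfolding V_def using that A(1) \<open>\<tau> > 0\<close> Emono[of i j]
      by (intro mult_mono power_increasing) (auto simp: E_def)
    have Vfar: "V (n + 2 * H) \<le> A ^ (2 * H) * (exp (\<epsilon> * real (4 * H * H)) * exp (\<epsilon> * real (4 * H)) ^ n) * V n" for n
    proof -
      let ?g = "exp (\<epsilon> * real (4 * H * H)) * exp (\<epsilon> * real (4 * H)) ^ n"
      have EE: "E (n + 2 * H) = ?g * E n"
        unfolding E_def exp_of_nat_mult[symmetric] exp_add[symmetric]
        by (simp add: power2_eq_square algebra_simps)
      have g1: "1 \<le> ?g"
      proof -
        have "1 * 1 \<le> ?g" using \<epsilon>(1) by (intro mult_mono one_le_power) auto
        then show ?thesis by simp
      qed
      have "V (n + 2 * H) = A ^ (2 * H) * (A ^ n * (1 + ?g * (\<tau> * E n)))"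
        unfolding V_def EE by (simp add: power_add mult_ac)
      also have "\<dots> \<le> A ^ (2 * H) * (A ^ n * (?g * 1 + ?g * (\<tau> * E n)))"
        using g1 A(1) by (intro mult_left_mono add_right_mono) auto
      also have "\<dots> = A ^ (2 * H) * ?g * V n" unfolding V_def by (simp only: distrib_left mult_ac)
      finally show ?thesis .
    qed
    let ?P = "\<lambda>S. \<forall>n\<ge>n1. norm (x n) \<le> S * V n"
    have "?P K"
    proof (rule self_improving_bound[of ?P "max 0 K' / \<tau>"])
      show "?P (max 0 K' / \<tau>)"
      proof (intro allI impI)
        fix n
        have "norm (x n) \<le> K' * E n" by (rule K')
        also have "\<dots> \<le> max 0 K' * E n" by (intro mult_right_mono) (auto simp: E_def)
        also have "\<dots> = max 0 K' / \<tau> * (1 * (0 + \<tau> * E n))" using \<open>\<tau> > 0\<close> by simp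
        also have "\<dots> \<le> max 0 K' / \<tau> * V n" unfolding V_def
          using A(1) \<open>\<tau> > 0\<close> by (intro mult_left_mono mult_mono add_right_mono) (auto simp: E_def)
        finally show "norm (x n) \<le> max 0 K' / \<tau> * V n" .
      qed
    next
      fix S T :: real assume "S \<le> T" "?P S"
      then show "?P T" using Vpos by (meson less_imp_le mult_right_mono order_trans)
    next
      fix S assume "S \<ge> K" and S: "?P S"
      then have "S \<ge> 0" using \<open>K > 0\<close> by simp
      show "?P (max K (S / 2))"
      proof (intro allI impI)
        fix N assume "N \<ge> n1"
        show "norm (x N) \<le> max K (S / 2) * V N"
        proof (cases "N < n2")
          case True
          then have "norm (x N) \<le> (\<Sum>n<n2. norm (x n))" by (intro member_le_sum) auto
          also have "\<dots> \<le> K * 1" unfolding K_def by simp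
          also have "\<dots> \<le> max K (S / 2) * V N" using V1 \<open>K > 0\<close> by (intro mult_mono) auto
          finally show ?thesis .
        next
          case False
          define n where "n = N - H - M"
          have n: "N = n + H + M" "n \<ge> n1" using False unfolding n_def n2_def by auto
          have n01: "n \<ge> n0" "n \<ge> n1'" using n(2) unfolding n1_def by auto
          have s1: "norm (shift_op R x (n + H)) \<le> l / 4 * (S * V N)"
          proof -
            have "(\<Sum>i\<le>2*H. norm (x (n + i))) \<le> (\<Sum>i\<le>2*H. S * V (n + 2 * H))"
            proof (rule sum_mono)
              fix i assume "i \<in> {..2*H}"
              then have "V (n + i) \<le> V (n + 2 * H)" by (intro Vmono) auto
              then have "S * V (n + i) \<le> S * V (n + 2 * H)" using \<open>S \<ge> 0\<close> by (rule mult_left_mono)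
              then show "norm (x (n + i)) \<le> S * V (n + 2 * H)"
                using S n(2) by (meson le_add1 order_trans)
            qed
            also have "\<dots> = real (2 * H + 1) * (S * V (n + 2 * H))" by simp
            also have "\<dots> \<le> real (2 * H + 1) * (S * (A ^ (2 * H) * (exp (\<epsilon> * real (4 * H * H)) * exp (\<epsilon> * real (4 * H)) ^ n) * V n))"
              using \<open>S \<ge> 0\<close> by (intro mult_left_mono Vfar) auto
            finally have "C * \<eta> ^ n * (\<Sum>i\<le>2*H. norm (x (n + i))) \<le> C * \<eta> ^ n * \<dots>"
              using \<open>C \<ge> 0\<close> assms(2) by (intro mult_left_mono) auto
            then have "norm (shift_op R x (n + H)) \<le> C * \<eta> ^ n *
                (real (2 * H + 1) * (S * (A ^ (2 * H) * (exp (\<epsilon> * real (4 * H * H)) * exp (\<epsilon> * real (4 * H)) ^ n) * V n)))"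
              by (rule order_trans[OF C[OF n01(1)]])
            also have "\<dots> = C1 * x1 ^ n * (S * V n)"
              unfolding C1_def x1_def power_mult_distrib by (simp only: mult_ac)
            also have "\<dots> \<le> l / 4 * (S * V n)"
              using n1'[OF n01(2)] \<open>S \<ge> 0\<close> Vpos[of n] by (intro mult_right_mono) auto
            also have "\<dots> \<le> l / 4 * (S * V N)"
              using l \<open>S \<ge> 0\<close> by (intro mult_left_mono Vmono) (auto simp: n(1))
            finally show ?thesis .
          qed
          have s2: "(\<Sum>i<M. norm (coeff R i) * norm (x (n + H + i))) \<le> l / 4 * (S * V N)"
          proof -
            have "(\<Sum>i<M. norm (coeff R i) * norm (x (n + H + i))) \<le> (\<Sum>i<M. norm (coeff R i) * (S * V N / A))"
            proof (intro sum_mono mult_left_mono)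
              fix i assume "i \<in> {..<M}"
              then have "V (n + H + i) \<le> V N / A" using Vstep[of "n + H + i" N] A(1) n(1)
                by (simp add: pos_le_divide_eq)
              then have "S * V (n + H + i) \<le> S * (V N / A)" using \<open>S \<ge> 0\<close> by (rule mult_left_mono)
              moreover have "norm (x (n + H + i)) \<le> S * V (n + H + i)" using S n(2) by simp
              ultimately show "norm (x (n + H + i)) \<le> S * V N / A" by simp
            qed auto
            also have "\<dots> = B / A * (S * V N)" unfolding B_def sum_distrib_right[symmetric] by simp
            also have "\<dots> \<le> l / 4 * (S * V N)"
              using BA \<open>S \<ge> 0\<close> Vpos[of N] by (intro mult_right_mono) auto
            finally show ?thesis .
          qed
          have "coeff R M * x N = shift_op R x (n + H) - (\<Sum>i<M. coeff R i * x (n + H + i))"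
            unfolding shift_op_def M_def[symmetric] n(1) lessThan_Suc_atMost[symmetric] by simp
          then have "l * norm (x N) \<le> norm (shift_op R x (n + H)) + norm (\<Sum>i<M. coeff R i * x (n + H + i))"
            unfolding l_def norm_mult[symmetric] by (simp add: norm_triangle_ineq4)
          also have "norm (\<Sum>i<M. coeff R i * x (n + H + i)) \<le> (\<Sum>i<M. norm (coeff R i) * norm (x (n + H + i)))"
            by (rule order_trans[OF norm_sum]) (simp add: norm_mult)
          finally have "l * norm (x N) \<le> l * (S / 2 * V N)" using s1 s2 by simp
          then have "norm (x N) \<le> S / 2 * V N" using l by (simp only: mult_le_cancel_left_pos)
          also have "\<dots> \<le> max K (S / 2) * V N" using Vpos[of N] by (intro mult_right_mono) auto
          finally show ?thesis .
        qed
      qed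
    qed (fact \<open>K > 0\<close>)
    then show ?thesis unfolding V_def .
  qed
  have "norm (x n) \<le> K * A ^ n" if "n \<ge> n1" for n
  proof (rule field_le_epsilon)
    fix t :: real assume "t > 0"
    define p where "p = K * A ^ n * E n"
    have p: "0 < p" unfolding p_def E_def using \<open>K > 0\<close> A(1) by simp
    have "norm (x n) \<le> K * (A ^ n * (1 + t / p * E n))"
      using main[of "t / p"] that \<open>t > 0\<close> p by simp
    also have "\<dots> = K * A ^ n + t / p * p" unfolding p_def by (simp only: distrib_left mult_ac mult_1_right)
    also have "\<dots> = K * A ^ n + t" using p by simp
    finally show "norm (x n) \<le> K * A ^ n + t" .
  qed
  then have "geom_bounded A x" using A(1) by (intro geom_bounded_eventually[of A n1 x K]) auto
  then show thesis using that[of A] A(1) by simp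
qed

text \<open>
  The recurrence is solved for its first main term. Against the weight \<open>\<theta> ^ n\<close> with a small \<open>\<theta>\<close> the later
  main terms contribute at most a quarter. If \<open>S\<close> bounds \<open>norm (x k) / \<theta> ^ k\<close> for \<open>k \<ge> n\<close>, then for
  \<open>k \<ge> n + H\<close> there remains only the perturbation, which is at most a constant times \<open>\<eta> ^ n * S\<close>. The
  product of these gains over the steps \<open>n, n + H, n + 2 * H, \<dots>\<close> is Gaussian.
\<close>
lemma perturbed_recurrence_rapid_decay:
  assumes "coeff R 0 \<noteq> 0" "0 < H" "0 < \<eta>" "\<eta> < 1" and rec: "perturbed_recurrence R \<eta> H x"
  obtains \<theta> where "0 < \<theta>"
    "geom_bounded \<theta> x \<Longrightarrow> \<exists>K c. 0 < c \<and> (\<forall>n. norm (x n) \<le> K * exp (- c * (real n)\<^sup>2))"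
proof -
  define M where "M = degree R"
  define l where "l = norm (coeff R 0)"
  have l: "0 < l" unfolding l_def using assms(1) by simp
  define B where "B = (\<Sum>i<M. norm (coeff R (Suc i)))"
  have "B \<ge> 0" unfolding B_def by (simp add: sum_nonneg)
  obtain C0 n0 where C0: "\<And>n. n \<ge> n0 \<Longrightarrow>
      norm (shift_op R x (n + H)) \<le> C0 * \<eta> ^ n * (\<Sum>i\<le>2*H. norm (x (n + i)))"
    using rec unfolding perturbed_recurrence_def by blast
  define C where "C = \<bar>C0\<bar> + 1"
  have C: "norm (shift_op R x (n + H)) \<le> C * \<eta> ^ n * (\<Sum>i\<le>2*H. norm (x (n + i)))" if "n \<ge> n0" for n
    unfolding C_def using assms(3)
    by (intro order_trans[OF C0[OF that]] mult_right_mono) (auto simp: sum_nonneg)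
  have "C > 0" unfolding C_def by simp
  define \<theta> where "\<theta> = min 1 (l / (4 * (B + 1)))"
  have \<theta>: "0 < \<theta>" "\<theta> \<le> 1" "B * \<theta> \<le> l / 4"
  proof -
    show "0 < \<theta>" "\<theta> \<le> 1" unfolding \<theta>_def using l \<open>B \<ge> 0\<close> by auto
    have "\<theta> \<le> l / (4 * (B + 1))" unfolding \<theta>_def by simp
    then have "\<theta> * (4 * (B + 1)) \<le> l" using \<open>B \<ge> 0\<close> by (simp add: pos_le_divide_eq)
    then show "B * \<theta> \<le> l / 4" using \<open>0 < \<theta>\<close> by (simp add: algebra_simps)
  qed
  define P where "P n S \<longleftrightarrow> (\<forall>k\<ge>n. norm (x k) \<le> S * \<theta> ^ k)" for n S
  have Pmono: "P n T" if "P n S" "S \<le> T" for n S T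
    unfolding P_def
  proof (intro allI impI)
    fix k assume "k \<ge> n"
    then have "norm (x k) \<le> S * \<theta> ^ k" using that(1) unfolding P_def by blast
    also have "\<dots> \<le> T * \<theta> ^ k" using that(2) \<theta>(1) by (intro mult_right_mono) auto
    finally show "norm (x k) \<le> T * \<theta> ^ k" .
  qed
  define C3 where "C3 = 4 * C * real (2 * H + 1) / (\<theta> ^ H * l)"
  have "C3 > 0" unfolding C3_def using \<open>C > 0\<close> \<theta>(1) l by simp
  have gain: "P (n + H) (C3 * \<eta> ^ n * S)" if "n \<ge> n0" "S > 0" and PS: "P n S" for n S
  proof -
    let ?K = "C3 * \<eta> ^ n * S"
    have "?K > 0" using \<open>C3 > 0\<close> assms(3) that(2) by simp
    show ?thesis
    proof (rule self_improving_bound[of "P (n + H)" S ?K])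
      show "P (n + H) S" using PS unfolding P_def by simp
      show "?K > 0" by fact
      show "P (n + H) U" if "T \<le> U" "P (n + H) T" for T U using Pmono that by blast
      fix T assume "T \<ge> ?K" and T: "P (n + H) T"
      then have "T \<ge> 0" using \<open>?K > 0\<close> by simp
      show "P (n + H) (max ?K (T / 2))"
        unfolding P_def
      proof (intro allI impI)
        fix N assume N: "N \<ge> n + H"
        define k where "k = N - H"
        have k: "N = k + H" "k \<ge> n" using N unfolding k_def by auto
        have "x N * coeff R 0 = shift_op R x (k + H) - (\<Sum>i<M. coeff R (Suc i) * x (k + H + Suc i))"
        proof -
          have "shift_op R x (k + H) = (\<Sum>i<Suc M. coeff R i * x (k + H + i))"
            unfolding shift_op_def M_def lessThan_Suc_atMost ..
          then show ?thesis unfolding k(1) sum.lessThan_Suc_shift by simp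
        qed
        then have s0: "norm (x N) * l \<le> norm (shift_op R x (k + H)) + norm (\<Sum>i<M. coeff R (Suc i) * x (k + H + Suc i))"
          unfolding l_def norm_mult[symmetric] by (simp add: norm_triangle_ineq4)
        have s1: "norm (\<Sum>i<M. coeff R (Suc i) * x (k + H + Suc i)) \<le> l / 4 * (T * \<theta> ^ N)"
        proof -
          have "norm (\<Sum>i<M. coeff R (Suc i) * x (k + H + Suc i)) \<le> (\<Sum>i<M. norm (coeff R (Suc i)) * norm (x (k + H + Suc i)))"
            by (rule order_trans[OF norm_sum]) (simp add: norm_mult)
          also have "\<dots> \<le> (\<Sum>i<M. norm (coeff R (Suc i)) * (T * \<theta> ^ Suc N))"
          proof (intro sum_mono mult_left_mono)
            fix i
            have "k + H + Suc i \<ge> n + H" using k(2) by simp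
            then have "norm (x (k + H + Suc i)) \<le> T * \<theta> ^ (k + H + Suc i)" using T unfolding P_def by blast
            also have "\<dots> \<le> T * \<theta> ^ Suc N"
              using \<theta> \<open>T \<ge> 0\<close> k(1) by (intro mult_left_mono power_decreasing) auto
            finally show "norm (x (k + H + Suc i)) \<le> T * \<theta> ^ Suc N" .
          qed auto
          also have "\<dots> = B * \<theta> * (T * \<theta> ^ N)" unfolding B_def sum_distrib_right[symmetric] by simp
          also have "\<dots> \<le> l / 4 * (T * \<theta> ^ N)"
            using \<theta> \<open>T \<ge> 0\<close> by (intro mult_right_mono) auto
          finally show ?thesis .
        qed
        have s2: "norm (shift_op R x (k + H)) \<le> l / 4 * (?K * \<theta> ^ N)"
        proof -
          have "k \<ge> n0" using k(2) that(1) by simp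
          have "(\<Sum>i\<le>2*H. norm (x (k + i))) \<le> (\<Sum>i\<le>2*H. S * \<theta> ^ k)"
          proof (rule sum_mono)
            fix i
            have "norm (x (k + i)) \<le> S * \<theta> ^ (k + i)" using PS k(2) unfolding P_def by simp
            also have "\<dots> \<le> S * \<theta> ^ k"
              using \<theta> that(2) by (intro mult_left_mono power_decreasing) auto
            finally show "norm (x (k + i)) \<le> S * \<theta> ^ k" .
          qed
          also have "\<dots> = real (2 * H + 1) * S * \<theta> ^ k" by simp
          finally have sumb: "(\<Sum>i\<le>2*H. norm (x (k + i))) \<le> real (2 * H + 1) * S * \<theta> ^ k" .
          have "norm (shift_op R x (k + H)) \<le> C * \<eta> ^ k * (\<Sum>i\<le>2*H. norm (x (k + i)))"
            by (rule C) fact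
          also have "\<dots> \<le> C * \<eta> ^ n * (real (2 * H + 1) * S * \<theta> ^ k)"
            using sumb k(2) \<open>C > 0\<close> assms(3,4)
            by (intro mult_mono mult_left_mono power_decreasing) (auto simp: sum_nonneg)
          also have "\<dots> = l / 4 * (?K * \<theta> ^ N)"
            unfolding C3_def k(1) power_add using \<theta>(1) l by simp
          finally show ?thesis .
        qed
        have s3: "l / 4 * (?K * \<theta> ^ N) + l / 4 * (T * \<theta> ^ N) \<le> (max ?K (T / 2) * \<theta> ^ N) * l"
        proof -
          have "?K + T \<le> 4 * max ?K (T / 2)" using \<open>?K > 0\<close> \<open>T \<ge> 0\<close> by simp
          then have "(?K + T) * (\<theta> ^ N * (l / 4)) \<le> 4 * max ?K (T / 2) * (\<theta> ^ N * (l / 4))"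
            using \<theta>(1) l by (intro mult_right_mono) auto
          then show ?thesis by (simp add: algebra_simps)
        qed
        have "norm (x N) * l \<le> (max ?K (T / 2) * \<theta> ^ N) * l" using s0 s1 s2 s3 by linarith
        then show "norm (x N) \<le> max ?K (T / 2) * \<theta> ^ N" using l by (rule mult_right_le_imp_le)
      qed
    qed
  qed
  show thesis
  proof (rule that[OF \<theta>(1)])
    assume "geom_bounded \<theta> x"
    then obtain D where D: "\<And>n. norm (x n) \<le> D * \<theta> ^ n" unfolding geom_bounded_def by blast
    obtain c where c: "0 < c" "\<eta> * exp (c * real (2 * H)) < 1"
      using small_exponent_exists[OF assms(3,4)] by blast
    define E where "E n = exp (- c * (real n)\<^sup>2)" for n :: nat
    obtain n1' where n1': "\<And>n. n \<ge> n1' \<Longrightarrow> C3 * exp (c * real (H * H)) * (\<eta> * exp (c * real (2 * H))) ^ n \<le> 1"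
      using eventually_const_times_power_le[of "\<eta> * exp (c * real (2 * H))" 1] c assms(3) by auto
    define n1 where "n1 = max n0 n1'"
    \<comment> \<open>For \<open>n < n1 + H\<close> the claim then follows from the geometric bound with the constant \<open>D\<close>.\<close>
    define K where "K = max 1 D / E (n1 + H)"
    have "K > 0" unfolding K_def E_def by simp
    have "P n (K * E n)" for n
    proof (induction n rule: less_induct)
      case (less n)
      show ?case
      proof (cases "n < n1 + H")
        case True
        have "(real n)\<^sup>2 \<le> (real (n1 + H))\<^sup>2" using True by (intro power_mono) auto
        then have "E (n1 + H) \<le> E n" unfolding E_def using c(1) by simp
        then have "max 1 D * E (n1 + H) \<le> max 1 D * E n" by (intro mult_left_mono) auto
        moreover have "E (n1 + H) > 0" by (simp add: E_def)
        ultimately have "max 1 D \<le> max 1 D * E n / E (n1 + H)" by (simp only: pos_le_divide_eq)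
        then have "max 1 D \<le> K * E n" unfolding K_def by (simp only: times_divide_eq_left)
        moreover have "P n D" using D unfolding P_def by blast
        ultimately show ?thesis using Pmono by auto
      next
        case False
        define k where "k = n - H"
        have k: "n = k + H" "k \<ge> n1" using False unfolding k_def by auto
        have k01: "k \<ge> n0" "k \<ge> n1'" using k(2) unfolding n1_def by auto
        have "P k (K * E k)" using less[of k] k(1) assms(2) by simp
        from gain[OF k01(1) _ this] have "P n (C3 * \<eta> ^ k * (K * E k))"
          using \<open>K > 0\<close> k(1) by (simp add: E_def)
        moreover have "C3 * \<eta> ^ k * (K * E k) \<le> K * E n"
        proof -
          have Ek: "E k = exp (c * real (H * H)) * exp (c * real (2 * H)) ^ k * E n"
            unfolding E_def k(1) exp_of_nat_mult[symmetric] exp_add[symmetric]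
            by (simp add: power2_eq_square algebra_simps)
          have "C3 * \<eta> ^ k * (K * E k) = C3 * exp (c * real (H * H)) * (\<eta> * exp (c * real (2 * H))) ^ k * (K * E n)"
            unfolding Ek power_mult_distrib by (simp only: mult_ac)
          also have "\<dots> \<le> 1 * (K * E n)"
            using n1'[OF k01(2)] \<open>K > 0\<close> by (intro mult_right_mono) (auto simp: E_def)
          finally show ?thesis by simp
        qed
        ultimately show ?thesis using Pmono by blast
      qed
    qed
    then have "norm (x n) \<le> K * E n * \<theta> ^ n" for n unfolding P_def by blast
    moreover have "K * E n * \<theta> ^ n \<le> K * E n * 1" for n
      using \<open>K > 0\<close> \<theta> by (intro mult_left_mono power_le_one) (auto simp: E_def)
    ultimately have "norm (x n) \<le> K * E n" for n by (metis mult.right_neutral order_trans)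
    then show "\<exists>K c. 0 < c \<and> (\<forall>n. norm (x n) \<le> K * exp (- c * (real n)\<^sup>2))"
      using c(1) unfolding E_def by blast
  qed
qed

lemma shift_op_perturbed_gain:
  assumes "perturbed_recurrence R \<eta> H x" "0 < \<eta>" "0 < A" "geom_bounded A x"
  shows "geom_bounded (\<eta> * A) (shift_op R x)"
proof -
  obtain C0 n0 where C0: "\<And>n. n \<ge> n0 \<Longrightarrow>
      norm (shift_op R x (n + H)) \<le> C0 * \<eta> ^ n * (\<Sum>i\<le>2*H. norm (x (n + i)))"
    using assms(1) unfolding perturbed_recurrence_def by blast
  obtain D where D: "\<And>n. norm (x n) \<le> D * A ^ n" using assms(4) unfolding geom_bounded_def by blast
  let ?C = "\<bar>C0\<bar> * (\<Sum>i\<le>2*H. D * A ^ i)"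
  have "norm (shift_op R x (n + H)) \<le> ?C * (\<eta> * A) ^ n" if "n \<ge> n0" for n
  proof -
    have "norm (shift_op R x (n + H)) \<le> C0 * \<eta> ^ n * (\<Sum>i\<le>2*H. norm (x (n + i)))" by (rule C0[OF that])
    also have "\<dots> \<le> \<bar>C0\<bar> * \<eta> ^ n * (\<Sum>i\<le>2*H. norm (x (n + i)))"
      using assms(2) by (intro mult_right_mono sum_nonneg) auto
    also have "\<dots> \<le> \<bar>C0\<bar> * \<eta> ^ n * (\<Sum>i\<le>2*H. D * A ^ (n + i))"
      using assms(2) by (intro mult_left_mono sum_mono D) auto
    also have "(\<Sum>i\<le>2*H. D * A ^ (n + i)) = A ^ n * (\<Sum>i\<le>2*H. D * A ^ i)"
      by (simp add: power_add sum_distrib_left mult_ac)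
    also have "\<bar>C0\<bar> * \<eta> ^ n * (A ^ n * (\<Sum>i\<le>2*H. D * A ^ i)) = ?C * (\<eta> * A) ^ n"
      by (simp add: power_mult_distrib)
    finally show ?thesis .
  qed
  then have "geom_bounded (\<eta> * A) (\<lambda>n. shift_op R x (n + H))"
    using assms(2,3) by (intro geom_bounded_eventually[of _ n0 _ ?C]) auto
  then show ?thesis by (rule geom_bounded_unshift) (use assms(2,3) in simp)
qed

text \<open>
  The modulus \<open>\<mu>\<close> is the exact exponential growth rate of \<open>x\<close>. It is finite by \<open>sub\<close> and positive by
  \<open>slow\<close>. The expansion is first obtained for one \<open>\<delta>1 < \<mu>\<close> that is larger than the moduli of all
  roots inside the disc of radius \<open>\<mu>\<close>.
  It carries over to larger \<open>\<delta>\<close> by monotonicity. For smaller \<open>\<delta>\<close> the error term is expanded once more;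
  this adds no new frequency, as no root has its modulus between \<open>\<delta>\<close> and \<open>\<delta>1\<close>.
\<close>
theorem perturbed_recurrence_asymptotics:
  fixes R :: "complex poly" and x :: "nat \<Rightarrow> complex"
  defines "\<Lambda> \<equiv> {w. poly R w = 0}"
  assumes R: "coeff R 0 \<noteq> 0" and "0 < H" and \<eta>: "0 < \<eta>" "\<eta> < 1"
    and rec: "perturbed_recurrence R \<eta> H x"
    and sub: "\<And>\<epsilon>. \<epsilon> > 0 \<Longrightarrow> \<exists>K. \<forall>n. norm (x n) \<le> K * exp (\<epsilon> * (real n)\<^sup>2)"
    and slow: "\<not> (\<exists>K c. 0 < c \<and> (\<forall>n. norm (x n) \<le> K * exp (- c * (real n)\<^sup>2)))"
  obtains \<mu> Q where "\<mu> \<in> norm ` \<Lambda>" "0 < \<mu>"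
    "\<And>w. w \<in> \<Lambda> \<Longrightarrow> degree (Q w) \<le> order w R - 1"
    "\<exists>w\<in>{w\<in>\<Lambda>. norm w = \<mu>}. Q w \<noteq> 0"
    "\<exists>\<delta>>0. \<delta> < \<mu> \<and> geom_bounded \<delta> (\<lambda>n. x n - (\<Sum>w\<in>{w\<in>\<Lambda>. norm w = \<mu>}. poly (Q w) (of_nat n) * w ^ n))"
    "\<And>\<delta>. (\<And>w. w \<in> \<Lambda> \<Longrightarrow> norm w < \<mu> \<Longrightarrow> norm w < \<delta>) \<Longrightarrow> \<eta> * \<mu> < \<delta> \<Longrightarrow>
       geom_bounded \<delta> (\<lambda>n. x n - (\<Sum>w\<in>{w\<in>\<Lambda>. norm w = \<mu>}. poly (Q w) (of_nat n) * w ^ n))"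
proof -
  have "R \<noteq> 0" using R by auto
  then have fin: "finite \<Lambda>" unfolding \<Lambda>_def by (rule poly_roots_finite)
  obtain A where A: "0 < A" "geom_bounded A x"
    by (rule perturbed_recurrence_geom_bounded[OF \<open>R \<noteq> 0\<close> \<eta> rec sub])
  obtain \<theta> where \<theta>: "0 < \<theta>" and "\<not> geom_bounded \<theta> x"
    using perturbed_recurrence_rapid_decay[OF R \<open>0 < H\<close> \<eta> rec] slow by metis
  define T where "T = {A. 0 < A \<and> geom_bounded A x}"
  have lower: "\<theta> \<le> B" if "B \<in> T" for B
    using that \<open>\<not> geom_bounded \<theta> x\<close> geom_bounded_mono[of B x \<theta>] unfolding T_def by force
  have "T \<noteq> {}" using A unfolding T_def by auto
  have bdd: "bdd_below T" using lower by (rule bdd_belowI)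
  define \<mu> where "\<mu> = Inf T"
  have "\<theta> \<le> \<mu>" unfolding \<mu>_def using \<open>T \<noteq> {}\<close> lower by (rule cInf_greatest)
  then have \<mu>: "0 < \<mu>" using \<theta> by simp
  have above: "geom_bounded B x" if "\<mu> < B" for B
  proof -
    obtain A' where "A' \<in> T" "A' < B"
      using \<open>\<mu> < B\<close> unfolding \<mu>_def cInf_less_iff[OF \<open>T \<noteq> {}\<close> bdd] by blast
    then show ?thesis unfolding T_def using geom_bounded_mono[of A' x B] by auto
  qed
  have below: "\<mu> \<le> B" if "0 < B" "geom_bounded B x" for B
    unfolding \<mu>_def using that bdd by (intro cInf_lower) (auto simp: T_def)
  \<comment> \<open>Here the perturbation gains the factor \<open>\<eta>\<close> over the bounds \<open>\<delta> / \<eta> > \<mu>\<close> for \<open>x\<close> itself.\<close>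
  have resid: "geom_bounded \<delta> (shift_op R x)" if "\<eta> * \<mu> < \<delta>" for \<delta>
  proof -
    have "\<mu> < \<delta> / \<eta>" using that \<eta>(1) by (simp add: pos_less_divide_eq mult.commute)
    then have "geom_bounded (\<eta> * (\<delta> / \<eta>)) (shift_op R x)"
      using \<mu> by (intro shift_op_perturbed_gain[OF rec \<eta>(1)] above) auto
    then show ?thesis using \<eta>(1) by simp
  qed
  define S where "S = insert (\<eta> * \<mu>) (norm ` {w\<in>\<Lambda>. norm w < \<mu>})"
  have "finite S" "S \<noteq> {}" unfolding S_def using fin by auto
  have "Max S < \<mu>"
    using \<eta> \<mu> \<open>finite S\<close> \<open>S \<noteq> {}\<close> by (subst Max_less_iff) (auto simp: S_def)
  then obtain \<delta>1 where \<delta>1: "Max S < \<delta>1" "\<delta>1 < \<mu>" using dense by blast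
  have S_less: "s < \<delta>1" if "s \<in> S" for s
    using that \<delta>1(1) \<open>finite S\<close> Max_ge[of S s] by linarith
  have "\<eta> * \<mu> < \<delta>1" by (rule S_less) (simp add: S_def)
  then have "0 < \<delta>1" using \<eta>(1) \<mu> by (meson less_trans mult_pos_pos)
  have roots: "norm w < \<delta>1 \<or> \<mu> \<le> norm w" if "w \<in> \<Lambda>" for w
    using that S_less[of "norm w"] unfolding S_def by force
  have no_root: "norm w \<noteq> \<delta>1" if "poly R w = 0" for w
    using that roots[of w] \<delta>1(2) unfolding \<Lambda>_def by auto
  obtain Q where Q: "\<And>w. Q w \<noteq> 0 \<Longrightarrow> degree (Q w) < order w R \<and> \<delta>1 < norm w \<and> norm w \<le> \<mu>"
    and hom: "\<And>n. shift_op R (exp_poly R Q) n = 0"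
    and err: "geom_bounded \<delta>1 (\<lambda>n. x n - exp_poly R Q n)"
    using exponential_polynomial_asymptotics[OF \<open>R \<noteq> 0\<close> \<open>0 < \<delta>1\<close> less_imp_le[OF \<delta>1(2)] no_root above
        resid[OF \<open>\<eta> * \<mu> < \<delta>1\<close>]] by blast
  have Q\<mu>: "w \<in> \<Lambda>" "norm w = \<mu>" if "Q w \<noteq> 0" for w
  proof -
    show "w \<in> \<Lambda>" using Q[OF that] order_0I[of R w] unfolding \<Lambda>_def by force
    then show "norm w = \<mu>" using roots[of w] Q[OF that] by linarith
  qed
  have ep: "exp_poly R Q n = (\<Sum>w\<in>{w\<in>\<Lambda>. norm w = \<mu>}. poly (Q w) (of_nat n) * w ^ n)" for n
    unfolding exp_poly_def \<Lambda>_def[symmetric]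
  proof (rule sum.mono_neutral_right)
    have "Q w = 0" if "norm w \<noteq> \<mu>" for w using that Q\<mu>(2) by blast
    then show "\<forall>w\<in>\<Lambda> - {w \<in> \<Lambda>. norm w = \<mu>}. poly (Q w) (of_nat n) * w ^ n = 0" by simp
  qed (use fin in auto)
  have ex: "\<exists>w. Q w \<noteq> 0"
  proof (rule ccontr)
    assume "\<not> ?thesis"
    then have "geom_bounded \<delta>1 x" using err unfolding exp_poly_def by simp
    then show False using below[OF \<open>0 < \<delta>1\<close>] \<delta>1(2) by simp
  qed
  show thesis
  proof (rule that[of \<mu> Q, folded ep])
    obtain w where "Q w \<noteq> 0" using ex by blast
    with Q\<mu>[OF this] show "\<mu> \<in> norm ` \<Lambda>" "\<exists>w\<in>{w\<in>\<Lambda>. norm w = \<mu>}. Q w \<noteq> 0" by blast+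
    show "0 < \<mu>" by fact
    show "degree (Q w) \<le> order w R - 1" for w using Q[of w] by (cases "Q w = 0") auto
    show "\<exists>\<delta>>0. \<delta> < \<mu> \<and> geom_bounded \<delta> (\<lambda>n. x n - exp_poly R Q n)"
      using \<open>0 < \<delta>1\<close> \<delta>1(2) err by blast
    fix \<delta> assume small: "\<And>w. w \<in> \<Lambda> \<Longrightarrow> norm w < \<mu> \<Longrightarrow> norm w < \<delta>" and \<delta>: "\<eta> * \<mu> < \<delta>"
    show "geom_bounded \<delta> (\<lambda>n. x n - exp_poly R Q n)"
    proof (cases "\<delta>1 \<le> \<delta>")
      case True
      then show ?thesis using err \<open>0 < \<delta>1\<close> by (rule geom_bounded_mono[rotated 2])
    next
      case False
      have "0 < \<delta>" using \<delta> \<eta>(1) \<mu> by (meson less_trans mult_pos_pos)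
      \<comment> \<open>As the exponential polynomial solves the recurrence exactly, subtracting it leaves \<open>shift_op R x\<close> unchanged.\<close>
      let ?e = "\<lambda>n. x n - exp_poly R Q n"
      have "shift_op R ?e = shift_op R x" by (rule ext) (simp add: shift_op_diff hom)
      then have "geom_bounded \<delta> (shift_op R ?e)" using resid[OF \<delta>] by simp
      moreover have "geom_bounded B ?e" if "\<delta>1 < B" for B
        using err \<open>0 < \<delta>1\<close> that by (intro geom_bounded_mono[OF err]) auto
      moreover have "norm w \<noteq> \<delta>" if "poly R w = 0" for w
        using that small[of w] roots[of w] False \<delta>1(2) unfolding \<Lambda>_def by force
      ultimately obtain Q' where
        Q': "\<And>w. Q' w \<noteq> 0 \<Longrightarrow> degree (Q' w) < order w R \<and> \<delta> < norm w \<and> norm w \<le> \<delta>1"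
        and err': "geom_bounded \<delta> (\<lambda>n. ?e n - exp_poly R Q' n)"
        using exponential_polynomial_asymptotics[of R \<delta> \<delta>1 ?e] \<open>R \<noteq> 0\<close> \<open>0 < \<delta>\<close> False by auto
      have "Q' w = 0" for w
      proof (rule ccontr)
        assume "Q' w \<noteq> 0"
        from Q'[OF this] have w: "order w R \<noteq> 0" "\<delta> < norm w" "norm w \<le> \<delta>1" by auto
        then have "w \<in> \<Lambda>" using order_0I[of R w] unfolding \<Lambda>_def by auto
        then show False using small[of w] w \<delta>1(2) by auto
      qed
      then show ?thesis using err' unfolding exp_poly_def by simp
    qed
  qed
qed

section \<open>The Newton-Puiseux diagram\<close>

lemma newton_puiseux_generator:
  assumes "j \<le> m" "a j \<noteq> 0" "real j \<le> x" "y \<le> real (degree (a j))"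
  shows "(x, y) \<in> newton_puiseux m a"
  unfolding newton_puiseux_def using assms by (intro hull_inc) blast

text \<open>
  Every other point of one of the quadrants whose convex hull is the diagram is the midpoint of the
  corner of that quadrant and of a further point of the same quadrant.
\<close>
lemma extreme_point_is_diagram_point:
  assumes "v extreme_point_of newton_puiseux m a"
  obtains j where "j \<le> m" "a j \<noteq> 0" "v = diagram_point a j"
proof -
  have "v \<in> (\<Union>j\<in>{j. j \<le> m \<and> a j \<noteq> 0}. {(x, y). real j \<le> x \<and> y \<le> real (degree (a j))})"
    using assms unfolding newton_puiseux_def by (rule extreme_point_of_convex_hull)
  then obtain j where j: "j \<le> m" "a j \<noteq> 0" "real j \<le> fst v" "snd v \<le> real (degree (a j))" by auto
  let ?p = "diagram_point a j" and ?q = "(2 * fst v - real j, 2 * snd v - real (degree (a j)))"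
  have "?p \<in> newton_puiseux m a" "?q \<in> newton_puiseux m a"
    unfolding diagram_point_def using j by (intro newton_puiseux_generator[of j]; simp)+
  moreover have "v = midpoint ?p ?q"
    unfolding diagram_point_def midpoint_def by (simp add: prod_eq_iff)
  ultimately have "?p = ?q"
    using assms midpoint_in_open_segment[of ?p ?q] unfolding extreme_point_of_def by auto
  then have "v = ?p" unfolding diagram_point_def by (auto simp: prod_eq_iff)
  then show thesis using that j by blast
qed

text \<open>
  Otherwise the vertex at \<open>j\<close> would lie on the chord, or vertically between a point of the chord and a
  lower point of the diagram.
\<close>
lemma extreme_point_above_chord:
  assumes ext: "diagram_point a j extreme_point_of newton_puiseux m a"
    and i: "i \<le> m" "a i \<noteq> 0" and l: "l \<le> m" "a l \<noteq> 0" and "i < j" "j < l"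
  shows "(real l - real j) * degree (a i) + (real j - real i) * degree (a l) < (real l - real i) * degree (a j)"
proof (rule ccontr)
  assume neg: "\<not> ?thesis"
  define t where "t = (real j - real i) / (real l - real i)"
  have t: "0 < t" "t < 1" unfolding t_def using assms by (auto simp: divide_simps)
  define y where "y = (1 - t) * degree (a i) + t * degree (a l)"
  have tx: "(1 - t) * real i + t * real l = real j"
    unfolding t_def using assms by (simp add: divide_simps) (simp add: algebra_simps)
  have "(real l - real i) * y = (real l - real j) * degree (a i) + (real j - real i) * degree (a l)"
  proof -
    have "(real l - real i) * t = real j - real i" "(real l - real i) * (1 - t) = real l - real j"
      unfolding t_def using assms by (auto simp: divide_simps)
    then show ?thesis unfolding y_def by (metis distrib_left mult.assoc)
  qed
  then have "(real l - real i) * degree (a j) \<le> (real l - real i) * y" using neg by simp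
  then have y: "degree (a j) \<le> y" using assms by simp
  have gen: "diagram_point a i \<in> newton_puiseux m a" "diagram_point a l \<in> newton_puiseux m a"
    unfolding diagram_point_def using i l by (auto intro: newton_puiseux_generator)
  have seg: "(real j, y) = (1 - t) *\<^sub>R diagram_point a i + t *\<^sub>R diagram_point a l"
    unfolding diagram_point_def y_def using tx by simp
  have ne: "diagram_point a i \<noteq> diagram_point a l" unfolding diagram_point_def using assms by auto
  have open1: "(real j, y) \<in> open_segment (diagram_point a i) (diagram_point a l)"
    unfolding in_segment seg using t ne by blast
  have yj: "y \<noteq> degree (a j)"
  proof
    assume "y = degree (a j)"
    then have "diagram_point a j \<in> open_segment (diagram_point a i) (diagram_point a l)"
      using open1 unfolding diagram_point_def by simp
    then show False using ext gen unfolding extreme_point_of_def by blast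
  qed
  let ?u = "(real j, y)" and ?v = "(real j, 2 * degree (a j) - y)"
  have "?u \<in> newton_puiseux m a"
    unfolding seg newton_puiseux_def
    by (rule convexD[OF convex_convex_hull gen[unfolded newton_puiseux_def]]) (use t in auto)
  moreover obtain j' where "j' \<le> m" "a j' \<noteq> 0" "diagram_point a j = diagram_point a j'"
    using extreme_point_is_diagram_point[OF ext] by blast
  then have "j \<le> m" "a j \<noteq> 0" unfolding diagram_point_def by auto
  then have "?v \<in> newton_puiseux m a" using y by (intro newton_puiseux_generator[of j]) auto
  moreover have "diagram_point a j \<in> open_segment ?u ?v"
  proof -
    have "diagram_point a j = midpoint ?u ?v" unfolding diagram_point_def midpoint_def by simp
    moreover have "?u \<noteq> ?v" using yj by auto
    ultimately show ?thesis using midpoint_in_open_segment by metis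
  qed
  ultimately show False using ext unfolding extreme_point_of_def by blast
qed

text \<open>
  A linear functional that decreases to the right and downwards attains its maximum over the diagram
  at a vertex: among the maximal points the leftmost one is extreme, because the points where
  the functional is smaller, together with the maximal points that are not further left, form a convex set.
\<close>
lemma extreme_point_maximizing:
  assumes "0 < M" "0 < N" and i: "i \<le> m" "a i \<noteq> 0"
  obtains j where "diagram_point a j extreme_point_of newton_puiseux m a"
    "N * real (degree (a i)) - M * real i \<le> N * real (degree (a j)) - M * real j"
proof -
  define J where "J = {j. j \<le> m \<and> a j \<noteq> 0}"
  define \<phi> where "\<phi> j = N * real (degree (a j)) - M * real j" for j
  have J: "finite J" "i \<in> J" unfolding J_def using i by auto
  define F where "F = Max (\<phi> ` J)"
  have F: "\<phi> j \<le> F" if "j \<in> J" for j unfolding F_def using that J by simp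
  have "F \<in> \<phi> ` J" unfolding F_def using J by (intro Max_in) auto
  define j where "j = Min {j\<in>J. \<phi> j = F}"
  have fin: "finite {j\<in>J. \<phi> j = F}" using J by simp
  have "j \<in> {j\<in>J. \<phi> j = F}" unfolding j_def using fin \<open>F \<in> \<phi> ` J\<close> by (intro Min_in) auto
  then have j: "j \<in> J" "\<phi> j = F" by auto
  have jmin: "j \<le> l" if "l \<in> J" "\<phi> l = F" for l unfolding j_def using fin that by simp
  define C where "C = {p. N * snd p - M * fst p < F \<or> (N * snd p - M * fst p = F \<and> real j \<le> fst p)}"
  have strict: "u * s + v * t < F"
    if "0 < u" "0 < v" "u + v = 1" "s \<le> F" "t \<le> F" "s < F \<or> t < F" for u v s t :: real
  proof -
    have "u * s \<le> u * F" "v * t \<le> v * F" using that by auto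
    moreover have "u * s < u * F \<or> v * t < v * F" using that by auto
    moreover have "u * F + v * F = F" using that(3) by (simp add: distrib_right[symmetric])
    ultimately show ?thesis by linarith
  qed
  have "convex C"
  proof (rule convexI)
    fix p q and u v :: real
    assume p: "p \<in> C" and q: "q \<in> C" and uv: "0 \<le> u" "0 \<le> v" "u + v = 1"
    have lin: "N * snd (u *\<^sub>R p + v *\<^sub>R q) - M * fst (u *\<^sub>R p + v *\<^sub>R q) =
        u * (N * snd p - M * fst p) + v * (N * snd q - M * fst q)"
      by (simp add: algebra_simps)
    show "u *\<^sub>R p + v *\<^sub>R q \<in> C"
    proof (cases "u = 0 \<or> v = 0")
      case True
      then show ?thesis using p q uv by auto
    next
      case False
      then have pos: "0 < u" "0 < v" using uv by auto
      show ?thesis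
      proof (cases "N * snd p - M * fst p = F \<and> N * snd q - M * fst q = F")
        case True
        then have x: "real j \<le> fst p" "real j \<le> fst q" using p q unfolding C_def by auto
        have "u * real j + v * real j \<le> u * fst p + v * fst q" using x uv by (intro add_mono mult_left_mono)
        then have "real j \<le> fst (u *\<^sub>R p + v *\<^sub>R q)" using uv by (simp add: distrib_right[symmetric])
        moreover have "u * F + v * F = F" using uv(3) by (simp add: distrib_right[symmetric])
        ultimately show ?thesis unfolding C_def mem_Collect_eq lin using True by simp
      next
        case False
        then have "u * (N * snd p - M * fst p) + v * (N * snd q - M * fst q) < F"
          using p q pos uv(3) unfolding C_def by (intro strict) auto
        then show ?thesis unfolding C_def mem_Collect_eq lin by blast
      qed
    qed
  qed
  have sub: "newton_puiseux m a \<subseteq> C"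
    unfolding newton_puiseux_def
  proof (rule hull_minimal[where S = convex], safe)
    fix l and x y :: real assume l: "l \<le> m" "a l \<noteq> 0" "real l \<le> x" "y \<le> real (degree (a l))"
    then have "l \<in> J" unfolding J_def by simp
    have le: "N * y \<le> N * real (degree (a l))" "M * real l \<le> M * x" using l assms by auto
    show "(x, y) \<in> C"
    proof (cases "N * y - M * x = F")
      case True
      then have "\<phi> l = F" using le F[OF \<open>l \<in> J\<close>] unfolding \<phi>_def by linarith
      then show ?thesis using True l(3) jmin[OF \<open>l \<in> J\<close>] unfolding C_def by auto
    next
      case False
      then show ?thesis using le F[OF \<open>l \<in> J\<close>] unfolding C_def \<phi>_def by simp
    qed
  qed (fact \<open>convex C\<close>)
  have "diagram_point a j extreme_point_of newton_puiseux m a"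
    unfolding extreme_point_of_def
  proof (intro conjI ballI notI)
    show "diagram_point a j \<in> newton_puiseux m a"
      unfolding diagram_point_def using j(1) by (intro newton_puiseux_generator[of j]) (auto simp: J_def)
    fix p q assume "p \<in> newton_puiseux m a" "q \<in> newton_puiseux m a"
      and seg: "diagram_point a j \<in> open_segment p q"
    then have p: "p \<in> C" and q: "q \<in> C" using sub by auto
    obtain v where "p \<noteq> q" and v: "0 < v" "v < 1" and e: "diagram_point a j = (1 - v) *\<^sub>R p + v *\<^sub>R q"
      using seg unfolding in_segment by auto
    have ex: "real j = (1 - v) * fst p + v * fst q" and ey: "real (degree (a j)) = (1 - v) * snd p + v * snd q"
      using e unfolding diagram_point_def by (auto simp: prod_eq_iff)
    have "F = (1 - v) * (N * snd p - M * fst p) + v * (N * snd q - M * fst q)"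
      using j(2) unfolding \<phi>_def ex ey by (simp add: algebra_simps)
    then have eq: "N * snd p - M * fst p = F" "N * snd q - M * fst q = F"
      using strict[of "1 - v" v "N * snd p - M * fst p" "N * snd q - M * fst q"] p q v unfolding C_def by auto
    then have xp: "real j \<le> fst p" "real j \<le> fst q" using p q unfolding C_def by auto
    have "(1 - v) * (fst p - real j) + v * (fst q - real j) = 0" using ex by (simp add: algebra_simps)
    moreover have "0 \<le> (1 - v) * (fst p - real j)" "0 \<le> v * (fst q - real j)" using xp v by auto
    ultimately have "(1 - v) * (fst p - real j) = 0" "v * (fst q - real j) = 0" by linarith+
    then have fsts: "fst p = real j" "fst q = real j" using v by auto
    have "N * snd p = N * snd q" using eq[unfolded fsts] by linarith
    then have "p = q" using fsts assms(2) by (simp add: prod_eq_iff)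
    then show False using \<open>p \<noteq> q\<close> by simp
  qed
  moreover have "\<phi> i \<le> \<phi> j" using F[OF J(2)] j(2) by simp
  ultimately show thesis using that unfolding \<phi>_def by blast
qed

text \<open>
  The line through two consecutive vertices supports the diagram. If a point were above it, then so
  would be some vertex, by \<open>extreme_point_maximizing\<close> for the functional \<open>N * y - M * x\<close>; this vertex
  is to the left or to the right of the edge, in contradiction to the strict concavity expressed by
  \<open>extreme_point_above_chord\<close>. The equation of the line is multiplied by \<open>N\<close> and
  arranged without subtraction, to stay in the natural numbers.
\<close>
lemma newton_puiseux_edge:
  assumes vert: "newton_puiseux_vertices m a K jv" and k: "k \<in> {1..K}"
    and pos: "0 < edge_height a jv k"
  defines "l \<equiv> jv (k - 1)" and "r \<equiv> jv k" and "M \<equiv> edge_height a jv k" and "N \<equiv> edge_width jv k"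
  shows "l < r" "r \<le> m" "a l \<noteq> 0" "a r \<noteq> 0" "r = l + N" "degree (a r) = degree (a l) + M"
    "\<And>j. j \<le> m \<Longrightarrow> a j \<noteq> 0 \<Longrightarrow> N * degree (a j) + M * l \<le> M * j + N * degree (a l)"
    "\<And>j. j \<in> edge_indices m a jv k \<longleftrightarrow>
       j \<le> m \<and> a j \<noteq> 0 \<and> N * degree (a j) + M * l = M * j + N * degree (a l)"
    "\<And>j. j \<in> edge_indices m a jv k \<Longrightarrow> l \<le> j \<and> j \<le> r"
proof -
  have mono: "strict_mono_on {0..K} jv"
    and ext: "{v. v extreme_point_of newton_puiseux m a} = (\<lambda>k. diagram_point a (jv k)) ` {0..K}"
    using vert unfolding newton_puiseux_vertices_def by auto
  have vext: "diagram_point a (jv i) extreme_point_of newton_puiseux m a" if "i \<le> K" for i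
    using ext that by (metis (mono_tags, lifting) atLeastAtMost_iff imageI le0 mem_Collect_eq)
  have vgen: "jv i \<le> m \<and> a (jv i) \<noteq> 0" if "i \<le> K" for i
    using extreme_point_is_diagram_point[OF vext[OF that]] unfolding diagram_point_def by (metis of_nat_eq_iff prod.inject)
  have kK: "k \<le> K" "k - 1 \<le> K" using k by auto
  show lr: "l < r" unfolding l_def r_def using k by (intro strict_mono_onD[OF mono]) auto
  show r: "r \<le> m" "a r \<noteq> 0" and l: "a l \<noteq> 0" using vgen[of k] vgen[of "k - 1"] kK unfolding l_def r_def by auto
  have "l \<le> m" using lr r by simp
  show N: "r = l + N" using lr unfolding N_def edge_width_def l_def r_def by simp
  show M: "degree (a r) = degree (a l) + M" using pos unfolding M_def edge_height_def l_def r_def by simp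
  have MN: "0 < real M" "0 < real N" using pos lr N unfolding M_def by auto
  have lext: "diagram_point a l extreme_point_of newton_puiseux m a"
    and rext: "diagram_point a r extreme_point_of newton_puiseux m a"
    using vext[of k] vext[of "k - 1"] kK unfolding l_def r_def by auto
  have rN: "real r = real l + real N" and rM: "real (degree (a r)) = real (degree (a l)) + real M"
    using N M by simp_all
  \<comment> \<open>The vertex at the nearer end of the edge lies above the chord from \<open>j\<close> to the farther end.\<close>
  have outside: "real N * degree (a j) - real M * j < real N * degree (a l) - real M * l"
    if j: "j \<le> m" "a j \<noteq> 0" "j < l \<or> r < j" for j
    using j(3)
  proof
    assume "j < l"
    from extreme_point_above_chord[OF lext j(1,2) r this lr]
    have "real N * degree (a j) + (real l - real j) * (degree (a l) + real M) < (real N + (real l - real j)) * degree (a l)"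
      unfolding rM rN by (simp add: algebra_simps)
    then show ?thesis by (simp add: algebra_simps)
  next
    assume "r < j"
    from extreme_point_above_chord[OF rext \<open>l \<le> m\<close> l j(1,2) lr this]
    have "(real j - real l - real N) * degree (a l) + real N * degree (a j) < (real j - real l) * (degree (a l) + real M)"
      unfolding rM rN by (simp add: algebra_simps)
    then show ?thesis by (simp add: algebra_simps)
  qed
  have below: "real N * degree (a j) - real M * j \<le> real N * degree (a l) - real M * l"
    if j: "j \<le> m" "a j \<noteq> 0" for j
  proof -
    obtain i where i: "diagram_point a i extreme_point_of newton_puiseux m a"
      and le: "real N * degree (a j) - real M * j \<le> real N * degree (a i) - real M * i"
      using extreme_point_maximizing[OF MN, where a = a] j by blast
    then have "diagram_point a i \<in> (\<lambda>k. diagram_point a (jv k)) ` {0..K}" using ext by blast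
    then obtain k' where k': "k' \<le> K" "i = jv k'" unfolding diagram_point_def by auto
    then have gen: "i \<le> m" "a i \<noteq> 0" using vgen by auto
    have "real N * degree (a i) - real M * i \<le> real N * degree (a l) - real M * l"
    proof (cases "i = l \<or> i = r")
      case True
      then show ?thesis unfolding rN rM by (elim disjE) (simp_all add: rN rM algebra_simps)
    next
      case False
      then have "k' \<noteq> k" "k' \<noteq> k - 1" unfolding k'(2) l_def r_def by auto
      then consider "k' < k - 1" | "k < k'" by linarith
      then have "i < l \<or> r < i"
        unfolding k'(2) l_def r_def using k k'(1) by cases (auto intro!: strict_mono_onD[OF mono])
      then show ?thesis using outside[OF gen] by simp
    qed
    then show ?thesis using le by simp
  qed
  show nat_below: "N * degree (a j) + M * l \<le> M * j + N * degree (a l)" if "j \<le> m" "a j \<noteq> 0" for j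
  proof -
    have "real (N * degree (a j) + M * l) \<le> real (M * j + N * degree (a l))" using below[OF that] by simp
    then show ?thesis by (simp only: of_nat_le_iff)
  qed
  have line: "diagram_point a j \<in> affine hull {diagram_point a l, diagram_point a r} \<longleftrightarrow>
      N * degree (a j) + M * l = M * j + N * degree (a l)" (is "?L \<longleftrightarrow> ?R") for j
  proof
    assume ?L
    then obtain u v where uv: "u + v = 1" and e: "diagram_point a j = u *\<^sub>R diagram_point a l + v *\<^sub>R diagram_point a r"
      unfolding affine_hull_2 by auto
    have "real j = u * l + v * r" "real (degree (a j)) = u * degree (a l) + v * degree (a r)"
      using e unfolding diagram_point_def by auto
    then have "real j = (u + v) * l + v * N" "real (degree (a j)) = (u + v) * degree (a l) + v * M"
      unfolding rN rM by (simp_all add: algebra_simps)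
    then have "real N * degree (a j) + real M * l = real M * j + real N * degree (a l)"
      unfolding uv by (simp add: algebra_simps)
    then have "real (N * degree (a j) + M * l) = real (M * j + N * degree (a l))" by simp
    then show ?R by (simp only: of_nat_eq_iff)
  next
    assume ?R
    then have "real (N * degree (a j) + M * l) = real (M * j + N * degree (a l))" by simp
    then have e: "real N * degree (a j) + real M * l = real M * j + real N * degree (a l)" by simp
    define v where "v = (real j - real l) / real N"
    have vN: "v * real N = real j - real l" unfolding v_def using MN by simp
    have "real N * (v * real M) = real N * (real (degree (a j)) - real (degree (a l)))"
    proof -
      have "real N * (v * real M) = (real j - real l) * real M" using vN by (metis mult.assoc mult.commute)
      then show ?thesis using e by (simp add: algebra_simps)
    qed
    then have vM: "v * real M = real (degree (a j)) - real (degree (a l))" using MN by simp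
    have "diagram_point a j = (1 - v) *\<^sub>R diagram_point a l + v *\<^sub>R diagram_point a r"
      unfolding diagram_point_def rN rM using vN vM by (simp add: algebra_simps)
    then show ?L unfolding affine_hull_2 by (intro CollectI exI[of _ "1 - v"] exI[of _ v]) simp
  qed
  show edge: "j \<in> edge_indices m a jv k \<longleftrightarrow>
       j \<le> m \<and> a j \<noteq> 0 \<and> N * degree (a j) + M * l = M * j + N * degree (a l)" for j
    unfolding edge_indices_def l_def[symmetric] r_def[symmetric] using line by simp
  show "l \<le> j \<and> j \<le> r" if "j \<in> edge_indices m a jv k" for j
  proof (rule ccontr)
    assume "\<not> ?thesis"
    then have "j < l \<or> r < j" by auto
    moreover have "j \<le> m" "a j \<noteq> 0" and e: "N * degree (a j) + M * l = M * j + N * degree (a l)"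
      using that edge by auto
    moreover have "real (N * degree (a j) + M * l) = real (M * j + N * degree (a l))" using e by simp
    ultimately show False using outside[of j] by simp
  qed
qed

section \<open>Maximum modulus and Taylor coefficients\<close>

lemma norm_le_max_modulus:
  assumes "f holomorphic_on UNIV" "norm z = r"
  shows "norm (f z) \<le> max_modulus r f"
proof -
  have "continuous_on (sphere 0 r) (\<lambda>z. norm (f z))"
    using assms(1) by (intro continuous_on_norm holomorphic_on_imp_continuous_on) (rule holomorphic_on_subset, auto)
  then have "bdd_above ((\<lambda>z. norm (f z)) ` sphere 0 r)"
    by (intro bounded_imp_bdd_above compact_imp_bounded compact_continuous_image compact_sphere)
  then show ?thesis unfolding max_modulus_def using assms(2) by (intro cSUP_upper) auto
qed

lemma max_modulus_nonneg:
  assumes "f holomorphic_on UNIV" "0 \<le> r"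
  shows "0 \<le> max_modulus r f"
  using norm_le_max_modulus[OF assms(1), of "of_real r" r] assms(2)
  by (intro order_trans[OF norm_ge_zero[of "f (of_real r)"]]) simp

lemma power_series_has_fps_expansion:
  fixes f :: "complex \<Rightarrow> complex"
  assumes "\<And>z. (\<lambda>n. c n * z ^ n) sums f z"
  shows "f has_fps_expansion Abs_fps c"
  using assms by (intro has_fps_expansionI always_eventually) simp

lemma power_series_coeff_le_max_modulus:
  assumes f: "f holomorphic_on UNIV" and \<alpha>: "\<And>z. (\<lambda>n. \<alpha> n * z ^ n) sums f z" and "0 < r"
  shows "norm (\<alpha> n) \<le> max_modulus r f / r ^ n"
proof -
  have "\<alpha> n = (deriv ^^ n) f 0 / fact n"
    using fps_nth_fps_expansion[OF power_series_has_fps_expansion[OF \<alpha>]] by simp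
  moreover have "norm ((deriv ^^ n) f 0) \<le> fact n * max_modulus r f / r ^ n"
  proof (rule Cauchy_inequality)
    show "f holomorphic_on ball 0 r" using f by (rule holomorphic_on_subset) simp
    show "continuous_on (cball 0 r) f"
      using f by (intro holomorphic_on_imp_continuous_on) (rule holomorphic_on_subset, auto)
    show "norm (f x) \<le> max_modulus r f" if "norm (0 - x) = r" for x
      using that by (intro norm_le_max_modulus[OF f]) simp
  qed fact
  then have "norm ((deriv ^^ n) f 0) / fact n \<le> fact n * max_modulus r f / r ^ n / fact n"
    by (intro divide_right_mono) auto
  ultimately show ?thesis by (simp add: norm_divide)
qed

text \<open>
  In \<open>norm (\<alpha> n) \<le> max_modulus r f / r ^ n\<close> the radius \<open>r = exp (2 * \<kappa> * n)\<close> minimises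
  \<open>(ln r)\<^sup>2 / (4 * \<kappa>) - n * ln r\<close>, with minimum \<open>- \<kappa> * n\<^sup>2\<close>.
\<close>
lemma growth_imp_coeff_upper_bound:
  assumes f: "f holomorphic_on UNIV" and \<alpha>: "\<And>z. (\<lambda>n. \<alpha> n * z ^ n) sums f z"
    and "0 < \<kappa>" "0 < \<epsilon>"
    and growth: "(\<lambda>r. ln (max_modulus r f)) \<sim>[at_top] (\<lambda>r. (ln r)\<^sup>2 / (4 * \<kappa>))"
  shows "\<exists>K. \<forall>n. norm (\<alpha> n) \<le> K * exp (- (\<kappa> - \<epsilon>) * (real n)\<^sup>2)"
proof -
  have "(\<lambda>r. ln (max_modulus r f) - (ln r)\<^sup>2 / (4 * \<kappa>)) \<in> o(\<lambda>r. (ln r)\<^sup>2 / (4 * \<kappa>))"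
    using growth by (rule asymp_equiv_imp_diff_smallo)
  from landau_o.smallD[OF this, of "\<epsilon> / \<kappa>"] have
    "eventually (\<lambda>r. ln (max_modulus r f) \<le> (1 + \<epsilon> / \<kappa>) * ((ln r)\<^sup>2 / (4 * \<kappa>))) at_top"
  proof (rule eventually_mono)
    show "0 < \<epsilon> / \<kappa>" using assms(3,4) by simp
    fix r assume "norm (ln (max_modulus r f) - (ln r)\<^sup>2 / (4 * \<kappa>)) \<le> \<epsilon> / \<kappa> * norm ((ln r)\<^sup>2 / (4 * \<kappa>))"
    moreover have "norm ((ln r)\<^sup>2 / (4 * \<kappa>)) = (ln r)\<^sup>2 / (4 * \<kappa>)" using assms(3) by simp
    ultimately have "ln (max_modulus r f) - (ln r)\<^sup>2 / (4 * \<kappa>) \<le> \<epsilon> / \<kappa> * ((ln r)\<^sup>2 / (4 * \<kappa>))"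
      by (simp only: real_norm_def abs_le_iff)
    then show "ln (max_modulus r f) \<le> (1 + \<epsilon> / \<kappa>) * ((ln r)\<^sup>2 / (4 * \<kappa>))"
      by (simp only: distrib_right mult_1)
  qed
  moreover have "filterlim (\<lambda>n. exp (2 * \<kappa> * real n)) at_top sequentially"
    using assms(3)
    by (intro filterlim_compose[OF exp_at_top] filterlim_tendsto_pos_mult_at_top[OF tendsto_const] filterlim_real_sequentially) auto
  ultimately have "eventually (\<lambda>n. ln (max_modulus (exp (2 * \<kappa> * real n)) f) \<le>
      (1 + \<epsilon> / \<kappa>) * ((ln (exp (2 * \<kappa> * real n)))\<^sup>2 / (4 * \<kappa>))) sequentially"
    by (rule eventually_compose_filterlim)
  then obtain n0 where n0: "\<And>n. n \<ge> n0 \<Longrightarrow> ln (max_modulus (exp (2 * \<kappa> * real n)) f) \<le>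
      (1 + \<epsilon> / \<kappa>) * ((2 * \<kappa> * real n)\<^sup>2 / (4 * \<kappa>))"
    unfolding eventually_sequentially by auto
  show ?thesis
  proof (rule eventually_bound_imp_bound)
    fix n assume "n \<ge> n0"
    let ?r = "exp (2 * \<kappa> * real n)"
    have "max_modulus ?r f \<le> exp (ln (max_modulus ?r f))"
      using max_modulus_nonneg[OF f, of ?r] by (cases "max_modulus ?r f = 0") auto
    also have "\<dots> \<le> exp ((1 + \<epsilon> / \<kappa>) * ((2 * \<kappa> * real n)\<^sup>2 / (4 * \<kappa>)))" using n0[OF \<open>n \<ge> n0\<close>] by simp
    finally have "norm (\<alpha> n) \<le> exp ((1 + \<epsilon> / \<kappa>) * ((2 * \<kappa> * real n)\<^sup>2 / (4 * \<kappa>))) / ?r ^ n"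
      by (intro order_trans[OF power_series_coeff_le_max_modulus[OF f \<alpha>, of ?r]] divide_right_mono) auto
    also have "\<dots> = exp ((1 + \<epsilon> / \<kappa>) * ((2 * \<kappa> * real n)\<^sup>2 / (4 * \<kappa>)) - 2 * \<kappa> * real n * real n)"
      by (simp add: exp_diff exp_of_nat_mult[symmetric] mult_ac)
    also have "(1 + \<epsilon> / \<kappa>) * ((2 * \<kappa> * real n)\<^sup>2 / (4 * \<kappa>)) - 2 * \<kappa> * real n * real n = - (\<kappa> - \<epsilon>) * (real n)\<^sup>2"
      using assms(3) by (simp add: power2_eq_square field_simps)
    finally show "norm (\<alpha> n) \<le> exp (- (\<kappa> - \<epsilon>) * (real n)\<^sup>2)" .
  qed simp
qed

text \<open>
  Coefficients of size \<open>exp (- (\<kappa> + \<epsilon>) * n\<^sup>2)\<close> would give the growth constant \<open>1 / (4 * c)\<close> with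
  \<open>c = \<kappa> + \<epsilon> / 2\<close>, by completing the square in the exponent; the other half of \<open>\<epsilon>\<close> makes the sum converge.
  But \<open>1 / (4 * c) < 1 / (4 * \<kappa>)\<close>.
\<close>
lemma growth_imp_not_coeff_upper_bound:
  assumes f: "f holomorphic_on UNIV" and \<alpha>: "\<And>z. (\<lambda>n. \<alpha> n * z ^ n) sums f z"
    and "0 < \<kappa>" "0 < \<epsilon>"
    and growth: "(\<lambda>r. ln (max_modulus r f)) \<sim>[at_top] (\<lambda>r. (ln r)\<^sup>2 / (4 * \<kappa>))"
  shows "\<not> (\<forall>n. norm (\<alpha> n) \<le> K * exp (- (\<kappa> + \<epsilon>) * (real n)\<^sup>2))"
proof
  assume K: "\<forall>n. norm (\<alpha> n) \<le> K * exp (- (\<kappa> + \<epsilon>) * (real n)\<^sup>2)"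
  have "K \<ge> 0" using order_trans[OF norm_ge_zero K[rule_format, of 0]] by simp
  define c where "c = \<kappa> + \<epsilon> / 2"
  have "0 < c" "\<kappa> < c" unfolding c_def using assms(3,4) by auto
  define S where "S = (K + 1) * (1 / (1 - exp (- (\<epsilon> / 2))))"
  have e1: "exp (- (\<epsilon> / 2)) < 1" using assms(4) by simp
  have "S > 0" unfolding S_def using \<open>K \<ge> 0\<close> e1 by simp
  have bound: "max_modulus r f \<le> S * exp ((ln r)\<^sup>2 / (4 * c))" if "r > 0" for r
  proof -
    define L where "L = ln r"
    have r: "r = exp L" unfolding L_def using that by simp
    have summand: "norm (\<alpha> n) * r ^ n \<le> (K + 1) * exp (L\<^sup>2 / (4 * c)) * exp (- (\<epsilon> / 2)) ^ n" for n
    proof -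
      have "norm (\<alpha> n) * r ^ n \<le> (K + 1) * exp (- (\<kappa> + \<epsilon>) * (real n)\<^sup>2) * exp (real n * L)"
      proof (rule mult_mono)
        show "norm (\<alpha> n) \<le> (K + 1) * exp (- (\<kappa> + \<epsilon>) * (real n)\<^sup>2)"
          using K[rule_format, of n] by (rule order_trans) (intro mult_right_mono, auto)
        show "r ^ n \<le> exp (real n * L)" unfolding r exp_of_nat_mult by simp
      qed (use \<open>K \<ge> 0\<close> that in auto)
      also have "\<dots> = (K + 1) * exp (- (\<kappa> + \<epsilon>) * (real n)\<^sup>2 + real n * L)" by (simp add: exp_add)
      also have "\<dots> \<le> (K + 1) * exp (L\<^sup>2 / (4 * c) + real n * (- (\<epsilon> / 2)))"
      proof -
        have "0 \<le> (2 * c * real n - L)\<^sup>2 / (4 * c)" using \<open>0 < c\<close> by simp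
        also have "\<dots> = c * (real n)\<^sup>2 - real n * L + L\<^sup>2 / (4 * c)"
          using \<open>0 < c\<close> by (simp add: power2_eq_square field_simps)
        finally have 1: "real n * L \<le> c * (real n)\<^sup>2 + L\<^sup>2 / (4 * c)" by simp
        have "real n \<le> (real n)\<^sup>2" by (cases n) (auto simp: power2_eq_square)
        then have "\<epsilon> / 2 * real n \<le> \<epsilon> / 2 * (real n)\<^sup>2" using assms(4) by (intro mult_left_mono) auto
        moreover have "(\<kappa> + \<epsilon>) * (real n)\<^sup>2 = c * (real n)\<^sup>2 + \<epsilon> / 2 * (real n)\<^sup>2"
          unfolding c_def by (simp add: algebra_simps)
        ultimately have "- (\<kappa> + \<epsilon>) * (real n)\<^sup>2 + real n * L \<le> L\<^sup>2 / (4 * c) + real n * (- (\<epsilon> / 2))"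
          using 1 unfolding mult_minus_left mult_minus_right mult.commute[of "real n" "\<epsilon> / 2"] by linarith
        then show ?thesis using \<open>K \<ge> 0\<close> by (intro mult_left_mono) auto
      qed
      also have "\<dots> = (K + 1) * exp (L\<^sup>2 / (4 * c)) * exp (- (\<epsilon> / 2)) ^ n"
        unfolding exp_add exp_of_nat_mult by simp
      finally show ?thesis .
    qed
    have sg: "(\<lambda>n. (K + 1) * exp (L\<^sup>2 / (4 * c)) * exp (- (\<epsilon> / 2)) ^ n) sums
        ((K + 1) * exp (L\<^sup>2 / (4 * c)) * (1 / (1 - exp (- (\<epsilon> / 2)))))"
      using e1 by (intro sums_mult geometric_sums) simp
    have "norm (f z) \<le> S * exp (L\<^sup>2 / (4 * c))" if z: "z \<in> sphere 0 r" for z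
    proof -
      have nt: "norm (\<alpha> n * z ^ n) \<le> (K + 1) * exp (L\<^sup>2 / (4 * c)) * exp (- (\<epsilon> / 2)) ^ n" for n
        using summand[of n] z by (simp add: norm_mult norm_power)
      have "norm (\<Sum>n. \<alpha> n * z ^ n) \<le> (\<Sum>n. (K + 1) * exp (L\<^sup>2 / (4 * c)) * exp (- (\<epsilon> / 2)) ^ n)"
        using nt sums_summable[OF sg] by (rule norm_suminf_le)
      then show ?thesis using sums_unique[OF \<alpha>[of z]] sums_unique[OF sg] unfolding S_def by (simp add: mult_ac)
    qed
    moreover have "sphere 0 r \<noteq> ({} :: complex set)" using that by simp
    ultimately show ?thesis unfolding max_modulus_def L_def[symmetric] by (intro cSUP_least) auto
  qed
  define a where "a = (1 / (4 * \<kappa>) + 1 / (4 * c)) / 2"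
  have "1 / (4 * c) < 1 / (4 * \<kappa>)" using \<open>\<kappa> < c\<close> assms(3) by (intro divide_strict_left_mono) auto
  then have a: "1 / (4 * c) < a" "a < 1 / (4 * \<kappa>)" unfolding a_def by auto
  have "0 < a" using a(1) \<open>0 < c\<close> by (meson less_trans zero_less_divide_1_iff zero_less_mult_pos2 mult_pos_pos zero_less_numeral)
  have "(\<lambda>r. ln (max_modulus r f) - (ln r)\<^sup>2 / (4 * \<kappa>)) \<in> o(\<lambda>r. (ln r)\<^sup>2 / (4 * \<kappa>))"
    using growth by (rule asymp_equiv_imp_diff_smallo)
  from landau_o.smallD[OF this, of "1 - 4 * \<kappa> * a"] have
    "eventually (\<lambda>r. norm (ln (max_modulus r f) - (ln r)\<^sup>2 / (4 * \<kappa>)) \<le> (1 - 4 * \<kappa> * a) * norm ((ln r)\<^sup>2 / (4 * \<kappa>))) at_top"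
    using a(2) assms(3) by (simp add: field_simps)
  then have low: "eventually (\<lambda>r. a * (ln r)\<^sup>2 \<le> ln (max_modulus r f)) at_top"
  proof eventually_elim
    case (elim r)
    have "(1 - 4 * \<kappa> * a) * ((ln r)\<^sup>2 / (4 * \<kappa>)) = (ln r)\<^sup>2 / (4 * \<kappa>) - a * (ln r)\<^sup>2"
      using assms(3) by (simp add: field_simps)
    then show ?case using elim assms(3) by simp
  qed
  have "filterlim (\<lambda>r::real. (a - 1 / (4 * c)) * (ln r)\<^sup>2) at_top at_top"
    using a(1)
    by (intro filterlim_tendsto_pos_mult_at_top[OF tendsto_const] filterlim_pow_at_top ln_at_top) auto
  then have "eventually (\<lambda>r. ln S < (a - 1 / (4 * c)) * (ln r)\<^sup>2) at_top"
    by (simp add: filterlim_at_top_dense)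
  with low have "eventually (\<lambda>r::real. False) at_top"
    using eventually_gt_at_top[of 1]
  proof eventually_elim
    case (elim r)
    have "0 < a * (ln r)\<^sup>2" using \<open>0 < a\<close> elim(3) by simp
    then have "0 < ln (max_modulus r f)" using elim(1) by linarith
    then have "0 < max_modulus r f" using max_modulus_nonneg[OF f, of r] elim(3)
      by (cases "max_modulus r f = 0") auto
    then have "ln (max_modulus r f) \<le> ln (S * exp ((ln r)\<^sup>2 / (4 * c)))"
      using bound[of r] elim(3) by (intro ln_mono) auto
    also have "\<dots> = ln S + (ln r)\<^sup>2 / (4 * c)" using \<open>S > 0\<close> by (simp add: ln_mult)
    finally show ?case using elim(1,2) by (simp add: algebra_simps)
  qed
  then show False by simp
qed

lemma q_difference_coeff_recurrence:
  fixes q :: complex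
  assumes \<alpha>: "\<And>z. (\<lambda>n. \<alpha> n * z ^ n) sums f z"
    and eq: "\<And>z. (\<Sum>j=0..m. poly (a j) z * f (q ^ j * z)) = poly b z"
    and H: "\<And>j. j \<le> m \<Longrightarrow> degree (a j) \<le> H" and n: "degree b < n" "H \<le> n"
  shows "(\<Sum>j\<le>m. \<Sum>i\<le>H. coeff (a j) i * (q ^ (j * (n - i)) * \<alpha> (n - i))) = 0"
proof -
  define G where "G j = Abs_fps (\<lambda>n. q ^ (j * n) * \<alpha> n)" for j
  have G: "(\<lambda>z. f (q ^ j * z)) has_fps_expansion G j" for j
    unfolding G_def
  proof (rule power_series_has_fps_expansion)
    fix z show "(\<lambda>n. q ^ (j * n) * \<alpha> n * z ^ n) sums f (q ^ j * z)"
    proof -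
      have "\<alpha> n * (q ^ j * z) ^ n = q ^ (j * n) * \<alpha> n * z ^ n" for n
        by (simp only: power_mult_distrib power_mult mult_ac)
      then show ?thesis using \<alpha>[of "q ^ j * z"] by (simp only:)
    qed
  qed
  have poly: "poly p has_fps_expansion fps_of_poly p" for p :: "complex poly"
  proof (rule has_fps_expansionI, rule always_eventually, rule allI)
    fix z :: complex
    have "(\<lambda>n. coeff p n * z ^ n) sums (\<Sum>n\<le>degree p. coeff p n * z ^ n)"
      by (rule sums_finite) (auto simp: coeff_eq_0)
    then show "(\<lambda>n. fps_nth (fps_of_poly p) n * z ^ n) sums poly p z" by (simp add: poly_altdef)
  qed
  have "(\<lambda>z. \<Sum>j\<le>m. poly (a j) z * f (q ^ j * z)) has_fps_expansion (\<Sum>j\<le>m. fps_of_poly (a j) * G j)"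
    by (intro has_fps_expansion_sum has_fps_expansion_mult G poly)
  then have "poly b has_fps_expansion (\<Sum>j\<le>m. fps_of_poly (a j) * G j)"
    using eq by (simp add: atLeast0AtMost)
  then have "fps_of_poly b = (\<Sum>j\<le>m. fps_of_poly (a j) * G j)"
    by (rule fps_expansion_unique_complex[OF poly])
  then have "fps_nth (fps_of_poly b) n = fps_nth (\<Sum>j\<le>m. fps_of_poly (a j) * G j) n" by simp
  then have "0 = (\<Sum>j\<le>m. \<Sum>i=0..n. coeff (a j) i * (q ^ (j * (n - i)) * \<alpha> (n - i)))"
    using n(1) by (simp add: fps_sum_nth fps_mult_nth G_def coeff_eq_0)
  also have "\<dots> = (\<Sum>j\<le>m. \<Sum>i\<le>H. coeff (a j) i * (q ^ (j * (n - i)) * \<alpha> (n - i)))"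
  proof (rule sum.cong[OF refl])
    fix j assume "j \<in> {..m}"
    then have "coeff (a j) i = 0" if "H < i" for i
      using that H[of j] by (intro coeff_eq_0) auto
    then show "(\<Sum>i=0..n. coeff (a j) i * (q ^ (j * (n - i)) * \<alpha> (n - i))) =
        (\<Sum>i\<le>H. coeff (a j) i * (q ^ (j * (n - i)) * \<alpha> (n - i)))"
      using n(2) by (intro sum.mono_neutral_right) auto
  qed
  finally show ?thesis by simp
qed

section \<open>The recurrence for the normalised coefficients\<close>

lemma twisted_coeff_eq_0_iff:
  assumes "q \<noteq> 0" "\<rho> \<noteq> 0"
  shows "twisted_coeff q \<rho> N a j i = 0 \<longleftrightarrow> coeff (a j) i = 0"
  unfolding twisted_coeff_def using assms by simp

text \<open>
  On the edge different indices have different degrees \<open>degree (a j)\<close>, because the slope is positive. Hence no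
  cancellation occurs among the monomials of the characteristic polynomial: its coefficients at the two
  ends of the edge are nonzero, and the recurrence belonging to the reciprocal polynomial can be written
  as a sum over the edge.
\<close>
lemma char_poly_edge:
  fixes q \<rho> :: complex
  assumes vert: "newton_puiseux_vertices m a K jv" and k: "k \<in> {1..K}"
    and M: "0 < edge_height a jv k" and nz: "q \<noteq> 0" "\<rho> \<noteq> 0"
  defines "P \<equiv> char_poly q \<rho> m a jv k"
  shows "coeff P 0 \<noteq> 0"
    "\<And>x n. shift_op (reflect_poly P) x n =
       (\<Sum>j\<in>edge_indices m a jv k. twisted_coeff q \<rho> (edge_width jv k) a j (degree (a j)) *
          x (n + degree (a (jv k)) - degree (a j)))"
proof -
  let ?l = "jv (k - 1)" and ?r = "jv k" and ?I = "edge_indices m a jv k"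
  define M where "M = edge_height a jv k"
  define N where "N = edge_width jv k"
  define D where "D = degree (a ?l)"
  define c where "c j = twisted_coeff q \<rho> N a j (degree (a j))" for j
  note edge = newton_puiseux_edge[OF vert k M, folded M_def N_def D_def]
  have N: "0 < N" using edge(1,5) by simp
  have Mpos: "0 < M" using M unfolding M_def by simp
  have c0: "c j \<noteq> 0" if "j \<in> ?I" for j
    using that edge(8)[of j] unfolding c_def twisted_coeff_eq_0_iff[OF nz] by simp
  have line: "N * degree (a j) + M * ?l = M * j + N * D" if "j \<in> ?I" for j
    using that edge(8) by blast
  have deg_ge: "D \<le> degree (a j)" if "j \<in> ?I" for j
  proof -
    have "M * ?l \<le> M * j" using edge(9)[OF that] by simp
    then have "N * D \<le> N * degree (a j)" using line[OF that] by linarith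
    then show ?thesis using N by simp
  qed
  have deg_le: "degree (a j) \<le> D + M" if "j \<in> ?I" for j
  proof -
    have "M * j \<le> M * (?l + N)" using edge(5) edge(9)[OF that] by simp
    then have "N * degree (a j) \<le> N * (D + M)" using line[OF that] by (simp add: algebra_simps)
    then show ?thesis using N by simp
  qed
  have inj: "j = j'" if "j \<in> ?I" "j' \<in> ?I" "degree (a j) = degree (a j')" for j j'
  proof -
    have "M * j + N * D = M * j' + N * D" using line[OF that(1)] line[OF that(2)] that(3) by simp
    then show ?thesis using Mpos by simp
  qed
  have lI: "?l \<in> ?I" unfolding edge(8) using edge(1-3) by (simp add: D_def)
  have "N * degree (a ?r) + M * ?l = M * ?r + N * D"
    unfolding edge(6) unfolding edge(5) by (simp add: algebra_simps)
  then have rI: "?r \<in> ?I" unfolding edge(8) using edge(2,4) by blast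
  have finI: "finite ?I" unfolding edge_indices_def by simp
  have P: "P = (\<Sum>j\<in>?I. monom (c j) (degree (a j) - D))"
    unfolding P_def char_poly_def c_def N_def D_def ..
  have coeffP: "coeff P (degree (a j) - D) = c j" if "j \<in> ?I" for j
  proof -
    have "coeff P (degree (a j) - D) = (\<Sum>j'\<in>?I. if j' = j then c j' else 0)"
      unfolding P coeff_sum coeff_monom
    proof (intro sum.cong refl if_cong)
      fix j' assume j': "j' \<in> ?I"
      show "(degree (a j') - D = degree (a j) - D) = (j' = j)"
        using inj[OF j' that] deg_ge[OF j'] deg_ge[OF that] by auto
    qed
    then show ?thesis using that finI by simp
  qed
  show "coeff P 0 \<noteq> 0" using coeffP[OF lI] c0[OF lI] by (simp add: D_def)
  have top: "coeff P M \<noteq> 0" using coeffP[OF rI] c0[OF rI] edge(6) by simp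
  have "degree P \<le> M" unfolding P
    by (intro degree_sum_le finI order_trans[OF degree_monom_le]) (use deg_le in force)
  then have degP: "degree P = M" using top le_degree[of P M] by simp
  show "shift_op (reflect_poly P) x n = (\<Sum>j\<in>?I. twisted_coeff q \<rho> (edge_width jv k) a j (degree (a j)) *
      x (n + degree (a ?r) - degree (a j)))" for x n
  proof -
    have "shift_op (reflect_poly P) x n = (\<Sum>i\<le>M. coeff (reflect_poly P) i * x (n + i))"
      using degree_reflect_poly_le[of P] degP by (intro shift_op_eq_sum) simp
    also have "\<dots> = (\<Sum>i\<le>M. coeff P (M - i) * x (n + i))"
      by (intro sum.cong refl) (simp add: coeff_reflect_poly degP)
    also have "\<dots> = (\<Sum>i\<le>M. coeff P i * x (n + (M - i)))"
      by (rule sum.reindex_bij_witness[of _ "\<lambda>i. M - i" "\<lambda>i. M - i"]) auto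
    also have "\<dots> = (\<Sum>i\<le>M. \<Sum>j\<in>?I. if degree (a j) - D = i then c j * x (n + (M - i)) else 0)"
      unfolding P coeff_sum coeff_monom sum_distrib_right by (intro sum.cong refl) auto
    also have "\<dots> = (\<Sum>j\<in>?I. \<Sum>i\<le>M. if degree (a j) - D = i then c j * x (n + (M - i)) else 0)"
      by (rule sum.swap)
    also have "\<dots> = (\<Sum>j\<in>?I. c j * x (n + degree (a ?r) - degree (a j)))"
    proof (intro sum.cong refl)
      fix j assume j: "j \<in> ?I"
      have "n + (M - (degree (a j) - D)) = n + degree (a ?r) - degree (a j)"
        using deg_ge[OF j] deg_le[OF j] edge(6) by simp
      then show "(\<Sum>i\<le>M. if degree (a j) - D = i then c j * x (n + (M - i)) else 0) =
          c j * x (n + degree (a ?r) - degree (a j))"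
        using deg_le[OF j] by simp
    qed
    finally show ?thesis unfolding c_def N_def .
  qed
qed

text \<open>
  The exponent of \<open>\<rho>\<close> on the left is \<open>2 * M * j * (n - i) + N * (n - i)\<^sup>2\<close>. It splits into a part without \<open>i\<close>
  and \<open>j\<close>, which is the same for all summands, the part \<open>N * i\<^sup>2 - 2 * M * j * i\<close>, which
  \<open>twisted_coeff\<close> absorbs, and \<open>2 * n * e\<close>, where \<open>e\<close> is the distance of \<open>(j, i)\<close> to the line of the edge in
  suitable units.
\<close>
lemma normalized_summand:
  fixes q \<rho> :: complex and M N n i j e l D :: nat
  assumes "\<rho> \<noteq> 0" and \<rho>: "\<rho> ^ (2 * M) = q" and "i \<le> n" and e: "M * j + N * D = M * l + N * i + e"
  shows "q ^ (j * (n - i)) * \<rho> ^ (N * (n - i)\<^sup>2) =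
    \<rho> powi (int N * (int n)\<^sup>2 + 2 * int n * (int M * int l - int N * int D)) *
      (\<rho> ^ (N * i\<^sup>2) * q powi (- int (j * i)) * (\<rho>\<^sup>2) ^ (n * e))"
proof -
  have q: "q = \<rho> powi (2 * int M)" unfolding \<rho>[symmetric] by (simp flip: power_int_of_nat)
  have "int (M * j + N * D) = int (M * l + N * i + e)" using e by simp
  then have e': "int e = int M * int j + int N * int D - int M * int l - int N * int i" by simp
  have ni: "int (n - i) = int n - int i" using assms(3) by simp
  have "q ^ (j * (n - i)) * \<rho> ^ (N * (n - i)\<^sup>2) =
      \<rho> powi (2 * int M * (int j * int (n - i)) + int N * (int (n - i))\<^sup>2)"
    unfolding q by (simp add: power_int_add assms(1) flip: power_int_of_nat power_int_mult)
  also have "2 * int M * (int j * int (n - i)) + int N * (int (n - i))\<^sup>2 =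
      (int N * (int n)\<^sup>2 + 2 * int n * (int M * int l - int N * int D)) +
      (int N * (int i)\<^sup>2 + 2 * int M * (- (int j * int i)) + 2 * (int n * int e))"
    unfolding e' ni by algebra
  also have "\<rho> powi \<dots> = \<rho> powi (int N * (int n)\<^sup>2 + 2 * int n * (int M * int l - int N * int D)) *
      (\<rho> powi (int N * (int i)\<^sup>2) * \<rho> powi (2 * int M * (- (int j * int i))) * \<rho> powi (2 * (int n * int e)))"
    by (simp only: power_int_add[OF disjI1[OF assms(1)]])
  also have "\<rho> powi (int N * (int i)\<^sup>2) = \<rho> ^ (N * i\<^sup>2)"
    using power_int_of_nat[of \<rho> "N * i\<^sup>2"] by (simp only: of_nat_mult of_nat_power)
  also have "\<rho> powi (2 * int M * (- (int j * int i))) = q powi (- int (j * i))"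
    unfolding q power_int_mult[symmetric] by (simp only: of_nat_mult)
  also have "\<rho> powi (2 * (int n * int e)) = (\<rho>\<^sup>2) ^ (n * e)"
    using power_int_of_nat[of \<rho> "2 * (n * e)"] by (simp only: of_nat_mult of_nat_numeral power_mult)
  finally show ?thesis .
qed

text \<open>
  The exponent \<open>e j i\<close> is a natural number for every monomial that occurs, as the line of the edge
  supports the diagram, and it vanishes exactly on the edge. The summands on the edge form the
  main part, and every other one has the small factor \<open>(\<rho>\<^sup>2) ^ (n * e j i)\<close> with \<open>e j i \<ge> 1\<close>.
\<close>
lemma normalized_coeff_perturbed_recurrence:
  fixes q \<rho> :: complex
  assumes vert: "newton_puiseux_vertices m a K jv" and k: "k \<in> {1..K}"
    and q: "0 < norm q" "norm q < 1"
    and \<alpha>: "\<And>z. (\<lambda>n. \<alpha> n * z ^ n) sums f z"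
    and equation: "\<And>z. (\<Sum>j=0..m. poly (a j) z * f (q ^ j * z)) = poly b z"
    and M: "0 < edge_height a jv k" and \<rho>: "\<rho> ^ (2 * edge_height a jv k) = q"
    and H: "\<And>j. j \<le> m \<Longrightarrow> degree (a j) \<le> H"
  shows "perturbed_recurrence (rate_poly q \<rho> m a jv k) ((norm \<rho>)\<^sup>2) H
           (\<lambda>n. \<alpha> n / \<rho> ^ (edge_width jv k * n\<^sup>2))"
proof -
  define M where "M = edge_height a jv k"
  define N where "N = edge_width jv k"
  define l where "l = jv (k - 1)"
  define D where "D = degree (a l)"
  define dr where "dr = degree (a (jv k))"
  define I where "I = edge_indices m a jv k"
  note edge = newton_puiseux_edge[OF vert k M, folded M_def N_def l_def D_def I_def dr_def]
  have Mpos: "0 < M" using M unfolding M_def .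
  have \<rho>M: "\<rho> ^ (2 * M) = q" using \<rho> unfolding M_def .
  have N: "0 < N" using edge(1,5) by simp
  have "q \<noteq> 0" using q(1) by auto
  then have "\<rho> \<noteq> 0" using \<rho>M Mpos by auto
  define \<beta> where "\<beta> n = \<alpha> n / \<rho> ^ (N * n\<^sup>2)" for n
  have \<alpha>\<beta>: "\<alpha> n = \<rho> ^ (N * n\<^sup>2) * \<beta> n" for n unfolding \<beta>_def using \<open>\<rho> \<noteq> 0\<close> by simp
  define \<eta> where "\<eta> = (norm \<rho>)\<^sup>2"
  have \<eta>: "0 < \<eta>" "\<eta> < 1"
  proof -
    show "0 < \<eta>" unfolding \<eta>_def using \<open>\<rho> \<noteq> 0\<close> by simp
    have "\<eta> ^ M = norm q" unfolding \<eta>_def \<rho>M[symmetric] by (simp add: norm_power power_mult)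
    then show "\<eta> < 1" using q(2) one_le_power[of \<eta> M] by linarith
  qed
  define c where "c = twisted_coeff q \<rho> N a"
  define e where "e j i = M * j + N * D - (M * l + N * i)" for j i
  have e: "M * j + N * D = M * l + N * i + e j i" if "j \<le> m" "c j i \<noteq> 0" for j i
  proof -
    have "coeff (a j) i \<noteq> 0"
      using that(2) unfolding c_def twisted_coeff_eq_0_iff[OF \<open>q \<noteq> 0\<close> \<open>\<rho> \<noteq> 0\<close>] .
    then have "a j \<noteq> 0" "i \<le> degree (a j)" using le_degree by auto
    then have "N * i \<le> N * degree (a j)" by simp
    then have "M * l + N * i \<le> M * j + N * D" using edge(7)[OF that(1) \<open>a j \<noteq> 0\<close>] by linarith
    then show ?thesis unfolding e_def by simp
  qed
  define main where "main j i \<longleftrightarrow> j \<in> I \<and> i = degree (a j)" for j i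
  have e0: "e j i = 0" if "main j i" for j i
    using that edge(8)[of j] unfolding main_def e_def by auto
  have e1: "0 < e j i" if "j \<le> m" "c j i \<noteq> 0" "\<not> main j i" for j i
  proof (rule ccontr)
    assume "\<not> ?thesis"
    then have eq: "M * j + N * D = M * l + N * i" using e[OF that(1,2)] by simp
    have "coeff (a j) i \<noteq> 0"
      using that(2) unfolding c_def twisted_coeff_eq_0_iff[OF \<open>q \<noteq> 0\<close> \<open>\<rho> \<noteq> 0\<close>] .
    then have aj: "a j \<noteq> 0" "i \<le> degree (a j)" using le_degree by auto
    then have "N * i \<le> N * degree (a j)" by simp
    then have "N * i = N * degree (a j)" using edge(7)[OF that(1) aj(1)] eq by linarith
    then have "i = degree (a j)" using N by simp
    moreover have "j \<in> I" unfolding edge(8) using that(1) aj(1) eq calculation by simp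
    ultimately show False using that(3) unfolding main_def by simp
  qed
  have rec: "(\<Sum>j\<le>m. \<Sum>i\<le>H. c j i * (\<rho>\<^sup>2) ^ (n * e j i) * \<beta> (n - i)) = 0" if n: "degree b < n" "H \<le> n" for n
  proof -
    let ?E = "\<rho> powi (int N * (int n)\<^sup>2 + 2 * int n * (int M * int l - int N * int D))"
    have "0 = (\<Sum>j\<le>m. \<Sum>i\<le>H. coeff (a j) i * (q ^ (j * (n - i)) * \<alpha> (n - i)))"
      using q_difference_coeff_recurrence[OF \<alpha> equation H n] by simp
    also have "\<dots> = (\<Sum>j\<le>m. \<Sum>i\<le>H. ?E * (c j i * (\<rho>\<^sup>2) ^ (n * e j i) * \<beta> (n - i)))"
    proof (intro sum.cong refl)
      fix j i assume ji: "j \<in> {..m}" "i \<in> {..H}"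
      show "coeff (a j) i * (q ^ (j * (n - i)) * \<alpha> (n - i)) = ?E * (c j i * (\<rho>\<^sup>2) ^ (n * e j i) * \<beta> (n - i))"
      proof (cases "c j i = 0")
        case True
        then have "coeff (a j) i = 0" unfolding c_def twisted_coeff_eq_0_iff[OF \<open>q \<noteq> 0\<close> \<open>\<rho> \<noteq> 0\<close>] .
        then show ?thesis using True by simp
      next
        case False
        then have e': "M * j + N * D = M * l + N * i + e j i" using e ji by simp
        have "i \<le> n" using ji n by simp
        have "coeff (a j) i * (q ^ (j * (n - i)) * \<alpha> (n - i)) =
            coeff (a j) i * (q ^ (j * (n - i)) * \<rho> ^ (N * (n - i)\<^sup>2)) * \<beta> (n - i)"
          unfolding \<alpha>\<beta> by (simp only: mult.assoc)
        then show ?thesis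
          unfolding normalized_summand[OF \<open>\<rho> \<noteq> 0\<close> \<rho>M \<open>i \<le> n\<close> e'] c_def twisted_coeff_def
          by (simp only: mult_ac)
      qed
    qed
    also have "\<dots> = ?E * (\<Sum>j\<le>m. \<Sum>i\<le>H. c j i * (\<rho>\<^sup>2) ^ (n * e j i) * \<beta> (n - i))"
      by (simp only: sum_distrib_left)
    finally show ?thesis using \<open>\<rho> \<noteq> 0\<close> by simp
  qed
  have dr: "dr \<le> H" unfolding dr_def using edge(2) by (rule H)
  define C where "C = (\<Sum>j\<le>m. \<Sum>i\<le>H. norm (c j i))"
  have "norm (shift_op (rate_poly q \<rho> m a jv k) \<beta> (n + H)) \<le> C * \<eta> ^ n * (\<Sum>i\<le>2*H. norm (\<beta> (n + i)))"
    if "n > degree b" for n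
  proof -
    \<comment> \<open>At the index \<open>?n\<close> the main terms of the recurrence are multiples of \<open>\<beta> (n + H), \<dots>, \<beta> (n + H + M)\<close>.\<close>
    let ?n = "n + H + dr" and ?B = "\<Sum>i\<le>2*H. norm (\<beta> (n + i))"
    let ?t = "\<lambda>j i. c j i * (\<rho>\<^sup>2) ^ (?n * e j i) * \<beta> (?n - i)"
    have "shift_op (rate_poly q \<rho> m a jv k) \<beta> (n + H) = (\<Sum>j\<in>I. c j (degree (a j)) * \<beta> (?n - degree (a j)))"
      unfolding rate_poly_def char_poly_edge(2)[OF vert k M \<open>q \<noteq> 0\<close> \<open>\<rho> \<noteq> 0\<close>] c_def N_def I_def dr_def ..
    also have "\<dots> = (\<Sum>j\<in>I. \<Sum>i\<le>H. if i = degree (a j) then ?t j i else 0)"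
    proof (intro sum.cong refl)
      fix j assume j: "j \<in> I"
      then have "degree (a j) \<le> H" using H edge(8) by blast
      moreover have "e j (degree (a j)) = 0" using j by (intro e0) (simp add: main_def)
      ultimately show "c j (degree (a j)) * \<beta> (?n - degree (a j)) = (\<Sum>i\<le>H. if i = degree (a j) then ?t j i else 0)"
        by (simp add: sum.delta)
    qed
    also have "\<dots> = (\<Sum>j\<le>m. \<Sum>i\<le>H. if main j i then ?t j i else 0)"
      by (rule sum.mono_neutral_cong_left) (auto simp: main_def edge(8))
    also have "\<dots> = (\<Sum>j\<le>m. \<Sum>i\<le>H. ?t j i) - (\<Sum>j\<le>m. \<Sum>i\<le>H. if main j i then 0 else ?t j i)"
      unfolding sum_subtractf[symmetric] by (intro sum.cong refl) auto
    also have "(\<Sum>j\<le>m. \<Sum>i\<le>H. ?t j i) = 0" using that by (intro rec) auto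
    finally have "norm (shift_op (rate_poly q \<rho> m a jv k) \<beta> (n + H)) =
        norm (\<Sum>j\<le>m. \<Sum>i\<le>H. if main j i then 0 else ?t j i)" by simp
    also have "\<dots> \<le> (\<Sum>j\<le>m. \<Sum>i\<le>H. norm (c j i) * (\<eta> ^ n * ?B))"
    proof (intro sum_norm_le)
      fix j i assume ji: "j \<in> {..m}" "i \<in> {..H}"
      have B0: "0 \<le> ?B" by (simp add: sum_nonneg)
      show "norm (if main j i then 0 else ?t j i) \<le> norm (c j i) * (\<eta> ^ n * ?B)"
      proof (cases "main j i \<or> c j i = 0")
        case True
        then show ?thesis using B0 \<eta> by auto
      next
        case False
        then have "1 \<le> e j i" using e1[of j i] ji by auto
        then have "?n * 1 \<le> ?n * e j i" by (intro mult_le_mono2)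
        then have "n \<le> ?n * e j i" unfolding mult_1_right by (rule order_trans[rotated]) simp
        then have "\<eta> ^ (?n * e j i) \<le> \<eta> ^ n" using \<eta> by (intro power_decreasing) auto
        then have 1: "norm ((\<rho>\<^sup>2) ^ (?n * e j i)) \<le> \<eta> ^ n" by (simp add: norm_power \<eta>_def)
        have "?n - i = n + (H + dr - i)" "H + dr - i \<in> {..2*H}" using ji dr by auto
        then have 2: "norm (\<beta> (?n - i)) \<le> ?B"
          using member_le_sum[of "H + dr - i" "{..2*H}" "\<lambda>i. norm (\<beta> (n + i))"] by simp
        show ?thesis using False 1 2 \<eta>
          by (auto simp: norm_mult mult.assoc intro!: mult_mono mult_left_mono)
      qed
    qed
    also have "\<dots> = C * \<eta> ^ n * ?B" unfolding C_def sum_distrib_right by (simp only: mult.assoc)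
    finally show ?thesis .
  qed
  then show ?thesis
    unfolding perturbed_recurrence_def \<beta>_def N_def \<eta>_def
    by (intro exI[of _ C] exI[of _ "Suc (degree b)"]) auto
qed

section \<open>Asymptotics of the Taylor coefficients\<close>

theorem theorem1p1:
  fixes q \<rho> :: complex
    and m K k M N :: nat
    and a :: "nat \<Rightarrow> complex poly" and b R :: "complex poly"
    and jv :: "nat \<Rightarrow> nat"
    and f :: "complex \<Rightarrow> complex" and \<alpha> :: "nat \<Rightarrow> complex"
    and \<Lambda> :: "complex set"
  assumes q: "0 < norm q" "norm q < 1"
    and f: "transcendental_entire f"
    and \<alpha>: "\<forall>z. (\<lambda>n. \<alpha> n * z ^ n) sums f z"
    and equation: "\<forall>z. (\<Sum>j=0..m. poly (a j) z * f (q ^ j * z)) = poly b z"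
    and vertices: "newton_puiseux_vertices m a K jv"
    and k: "k \<in> {1..K}"
    and growth: "(\<lambda>r. ln (max_modulus r f))
                   \<sim>[at_top] (\<lambda>r. slope a jv k / (- 2 * ln (norm q)) * (ln r)\<^sup>2)"
    and M: "M = edge_height a jv k"
    and N: "N = edge_width jv k"
    and \<rho>: "\<rho> ^ (2 * M) = q"
    and R: "R = rate_poly q \<rho> m a jv k"
    and \<Lambda>: "\<Lambda> = {z. poly R z = 0}"
  shows "\<exists>\<mu> \<in> norm ` \<Lambda>. \<exists>Q :: complex \<Rightarrow> complex poly.
           (\<forall>w\<in>{w\<in>\<Lambda>. norm w = \<mu>}. degree (Q w) \<le> order w R - 1) \<and>
           (\<exists>w\<in>{w\<in>\<Lambda>. norm w = \<mu>}. Q w \<noteq> 0) \<and>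
           (\<exists>\<delta>::real. 0 < \<delta> \<and> \<delta> < \<mu> \<and>
              (\<lambda>n. \<alpha> n / \<rho> ^ (N * n\<^sup>2) -
                   (\<Sum>w\<in>{w\<in>\<Lambda>. norm w = \<mu>}. poly (Q w) (of_nat n) * w ^ n))
                \<in> O(\<lambda>n. of_real \<delta> ^ n)) \<and>
           (\<forall>\<delta>::real. (\<forall>w\<in>\<Lambda>. norm w < \<mu> \<longrightarrow> norm w < \<delta>) \<and> (norm \<rho>)\<^sup>2 * \<mu> < \<delta> \<longrightarrow>
              (\<lambda>n. \<alpha> n / \<rho> ^ (N * n\<^sup>2) -
                   (\<Sum>w\<in>{w\<in>\<Lambda>. norm w = \<mu>}. poly (Q w) (of_nat n) * w ^ n))
                \<in> O(\<lambda>n. of_real \<delta> ^ n))"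
proof -
  have holo: "f holomorphic_on UNIV" using f unfolding transcendental_entire_def by blast
  have sums: "\<And>z. (\<lambda>n. \<alpha> n * z ^ n) sums f z" using \<alpha> by blast
  have "q \<noteq> 0" using q(1) by auto
  \<comment> \<open>If \<open>jv\<close> did not move upwards at \<open>k\<close>, the equation for \<open>\<rho>\<close> would read \<open>1 = q\<close>.\<close>
  have Mpos: "0 < M"
  proof (rule ccontr)
    assume "\<not> 0 < M"
    then have "q = 1" using \<rho> by simp
    then show False using q(2) by simp
  qed
  then have M0: "0 < edge_height a jv k" unfolding M .
  note edge = newton_puiseux_edge[OF vertices k M0, folded M N]
  have Npos: "0 < N" using edge(1,5) by simp
  have "\<rho> \<noteq> 0" using \<rho> \<open>q \<noteq> 0\<close> Mpos by auto
  have "norm \<rho> ^ (2 * M) = norm q" unfolding \<rho>[symmetric] by (simp add: norm_power)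
  then have \<rho>1: "norm \<rho> < 1" using q(2) one_le_power[of "norm \<rho>" "2 * M"] by linarith
  have lnq: "ln (norm q) = 2 * real M * ln (norm \<rho>)"
    unfolding \<rho>[symmetric] using \<open>\<rho> \<noteq> 0\<close> by (simp add: norm_power ln_realpow)
  \<comment> \<open>Both the normalisation and the growth hypothesis are expressed by \<open>\<kappa>\<close>: \<open>norm (\<rho> ^ (N * n\<^sup>2)) = exp (- \<kappa> * n\<^sup>2)\<close>.\<close>
  define \<kappa> where "\<kappa> = - (real N * ln (norm \<rho>))"
  have ln\<rho>: "ln (norm \<rho>) < 0" using \<rho>1 \<open>\<rho> \<noteq> 0\<close> by simp
  then have \<kappa>: "0 < \<kappa>" unfolding \<kappa>_def using Npos by (simp add: mult_pos_neg)
  have norm\<rho>: "norm \<rho> ^ (N * n\<^sup>2) = exp (- \<kappa> * (real n)\<^sup>2)" for n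
  proof -
    have "norm \<rho> ^ (N * n\<^sup>2) = exp (ln (norm \<rho>)) ^ (N * n\<^sup>2)" using \<open>\<rho> \<noteq> 0\<close> by simp
    also have "\<dots> = exp (real (N * n\<^sup>2) * ln (norm \<rho>))" by (simp only: exp_of_nat_mult)
    also have "real (N * n\<^sup>2) * ln (norm \<rho>) = - \<kappa> * (real n)\<^sup>2" unfolding \<kappa>_def by simp
    finally show ?thesis .
  qed
  have "slope a jv k = real M / real N"
    unfolding slope_def using edge(5,6) by simp
  then have "slope a jv k / (- 2 * ln (norm q)) * L\<^sup>2 = L\<^sup>2 / (4 * \<kappa>)" for L
    unfolding lnq \<kappa>_def using Mpos Npos ln\<rho> by (simp add: field_simps)
  then have growth': "(\<lambda>r. ln (max_modulus r f)) \<sim>[at_top] (\<lambda>r. (ln r)\<^sup>2 / (4 * \<kappa>))"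
    using growth by simp
  define \<beta> where "\<beta> n = \<alpha> n / \<rho> ^ (N * n\<^sup>2)" for n
  have norm\<beta>: "norm (\<beta> n) = norm (\<alpha> n) * exp (\<kappa> * (real n)\<^sup>2)" for n
    unfolding \<beta>_def norm_divide norm_power norm\<rho> by (simp add: exp_minus field_simps)
  have sub: "\<exists>K. \<forall>n. norm (\<beta> n) \<le> K * exp (\<epsilon> * (real n)\<^sup>2)" if \<epsilon>: "\<epsilon> > 0" for \<epsilon>
  proof -
    obtain K where K: "\<And>n. norm (\<alpha> n) \<le> K * exp (- (\<kappa> - \<epsilon>) * (real n)\<^sup>2)"
      using growth_imp_coeff_upper_bound[OF holo sums \<kappa> \<epsilon> growth'] by blast
    have "norm (\<beta> n) \<le> K * exp (\<epsilon> * (real n)\<^sup>2)" for n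
    proof -
      have "norm (\<beta> n) \<le> K * exp (- (\<kappa> - \<epsilon>) * (real n)\<^sup>2) * exp (\<kappa> * (real n)\<^sup>2)"
        unfolding norm\<beta> by (intro mult_right_mono K) simp
      also have "\<dots> = K * exp (\<epsilon> * (real n)\<^sup>2)"
        by (simp add: mult.assoc exp_add[symmetric] algebra_simps)
      finally show ?thesis .
    qed
    then show ?thesis by blast
  qed
  have slow: "\<not> (\<exists>K c. 0 < c \<and> (\<forall>n. norm (\<beta> n) \<le> K * exp (- c * (real n)\<^sup>2)))"
  proof
    assume "\<exists>K c. 0 < c \<and> (\<forall>n. norm (\<beta> n) \<le> K * exp (- c * (real n)\<^sup>2))"
    then obtain K c where c: "0 < c" and K: "\<And>n. norm (\<beta> n) \<le> K * exp (- c * (real n)\<^sup>2)" by blast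
    have "norm (\<alpha> n) \<le> K * exp (- (\<kappa> + c) * (real n)\<^sup>2)" for n
    proof -
      have "norm (\<alpha> n) = norm (\<beta> n) * exp (- \<kappa> * (real n)\<^sup>2)"
        unfolding norm\<beta> by (simp add: exp_minus)
      also have "\<dots> \<le> K * exp (- c * (real n)\<^sup>2) * exp (- \<kappa> * (real n)\<^sup>2)"
        by (intro mult_right_mono K) simp
      also have "\<dots> = K * exp (- (\<kappa> + c) * (real n)\<^sup>2)"
        by (simp add: mult.assoc exp_add[symmetric] algebra_simps)
      finally show ?thesis .
    qed
    then show False using growth_imp_not_coeff_upper_bound[OF holo sums \<kappa> c growth'] by blast
  qed
  define H where "H = (\<Sum>j\<le>m. degree (a j))"
  have H: "degree (a j) \<le> H" if "j \<le> m" for j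
    unfolding H_def using that by (intro member_le_sum) auto
  have "M \<le> H" using H[OF edge(2)] edge(6) by simp
  then have "0 < H" using Mpos by simp
  have R0: "coeff R 0 \<noteq> 0"
    unfolding R rate_poly_def
    using char_poly_edge(1)[OF vertices k M0 \<open>q \<noteq> 0\<close> \<open>\<rho> \<noteq> 0\<close>] by auto
  have \<eta>: "0 < (norm \<rho>)\<^sup>2" "(norm \<rho>)\<^sup>2 < 1"
    using \<open>\<rho> \<noteq> 0\<close> \<rho>1 by (auto simp: power_less_one_iff)
  have rec: "perturbed_recurrence R ((norm \<rho>)\<^sup>2) H \<beta>"
    unfolding R \<beta>_def N
    by (rule normalized_coeff_perturbed_recurrence[OF vertices k q sums _ M0 \<rho>[unfolded M] H])
      (use equation in auto)
  obtain \<mu> Q where \<mu>: "\<mu> \<in> norm ` \<Lambda>" "0 < \<mu>"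
    and deg: "\<And>w. w \<in> \<Lambda> \<Longrightarrow> degree (Q w) \<le> order w R - 1"
    and nz: "\<exists>w\<in>{w\<in>\<Lambda>. norm w = \<mu>}. Q w \<noteq> 0"
    and ex: "\<exists>\<delta>>0. \<delta> < \<mu> \<and> geom_bounded \<delta> (\<lambda>n. \<beta> n - (\<Sum>w\<in>{w\<in>\<Lambda>. norm w = \<mu>}. poly (Q w) (of_nat n) * w ^ n))"
    and all: "\<And>\<delta>. (\<And>w. w \<in> \<Lambda> \<Longrightarrow> norm w < \<mu> \<Longrightarrow> norm w < \<delta>) \<Longrightarrow> (norm \<rho>)\<^sup>2 * \<mu> < \<delta> \<Longrightarrow>
       geom_bounded \<delta> (\<lambda>n. \<beta> n - (\<Sum>w\<in>{w\<in>\<Lambda>. norm w = \<mu>}. poly (Q w) (of_nat n) * w ^ n))"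
    using perturbed_recurrence_asymptotics[OF R0 \<open>0 < H\<close> \<eta> rec sub slow, folded \<Lambda>] by blast
  show ?thesis
  proof (intro bexI[OF _ \<mu>(1)] exI[of _ Q] conjI allI impI)
    show "\<forall>w\<in>{w\<in>\<Lambda>. norm w = \<mu>}. degree (Q w) \<le> order w R - 1" using deg by blast
    show "\<exists>w\<in>{w\<in>\<Lambda>. norm w = \<mu>}. Q w \<noteq> 0" by fact
    show "\<exists>\<delta>::real. 0 < \<delta> \<and> \<delta> < \<mu> \<and> (\<lambda>n. \<alpha> n / \<rho> ^ (N * n\<^sup>2) -
        (\<Sum>w\<in>{w\<in>\<Lambda>. norm w = \<mu>}. poly (Q w) (of_nat n) * w ^ n)) \<in> O(\<lambda>n. of_real \<delta> ^ n)"
      using ex geom_bounded_iff_bigo unfolding \<beta>_def by blast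
    fix \<delta> :: real assume \<delta>: "(\<forall>w\<in>\<Lambda>. norm w < \<mu> \<longrightarrow> norm w < \<delta>) \<and> (norm \<rho>)\<^sup>2 * \<mu> < \<delta>"
    have "0 < (norm \<rho>)\<^sup>2 * \<mu>" using \<eta>(1) \<mu>(2) by (rule mult_pos_pos)
    then have "0 < \<delta>" using \<delta> by linarith
    moreover have "geom_bounded \<delta> (\<lambda>n. \<beta> n - (\<Sum>w\<in>{w\<in>\<Lambda>. norm w = \<mu>}. poly (Q w) (of_nat n) * w ^ n))"
      using \<delta> by (intro all) auto
    ultimately show "(\<lambda>n. \<alpha> n / \<rho> ^ (N * n\<^sup>2) -
        (\<Sum>w\<in>{w\<in>\<Lambda>. norm w = \<mu>}. poly (Q w) (of_nat n) * w ^ n)) \<in> O(\<lambda>n. of_real \<delta> ^ n)"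
      using geom_bounded_iff_bigo unfolding \<beta>_def by blast
  qed
qed

end
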